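(* Let $(X,d)$ be a compact metric space and let $H^{(N)}$ be a sequence of $N$-particle Hamiltonians on $X$ such that: (i) $H^{(N)}/N$ is equicontinuous; (ii) for every $u\in C^0(X)$ the limit $\mathcal{F}(u):=\lim_{N\to\infty}\inf_{X^N}\frac1N\big(H^{(N)}+\sum_i u(x_i)\big)$ exists; (iii) $\mathcal{F}$ is Gateaux differentiable on $C^0(X)$. Then, for every Borel probability measure $\mu$ on $X$, $$\lim_{N\to\infty}\frac1N\int_{X^N}H^{(N)}\mu^{\otimes N}=E(\mu),\qquad E(\mu):=\sup_{u\in C^0(X)}\Big(\mathcal{F}(u)-\int_X u\,\mu\Big).$$
   Context: An $N$-particle Hamiltonian is a continuous function $H^{(N)}:X^N\to\mathbb{R}$ that is invariant under permutations of the coordinates. With $d_{X^N}(x,y)=\frac1N\sum_{i=1}^N d(x_i,y_i)$, equicontinuity of $H^{(N)}/N$ means: for every $\epsilon>0$ there is $\delta>0$, independent of $N$, such that $|H^{(N)}(x)-H^{(N)}(y)|/N\le\epsilon$ whenever $d_{X^N}(x,y)\le\delta$. Gateaux differentiable means differentiable along all affine lines in $C^0(X)$. (The space $X$ is also equipped with a fixed background probability measure $\mu_0$ whose support is $X$.) *)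

theory Defs
  imports "HOL-Probability.Probability" "HOL-Combinatorics.Permutations"
begin

(* Points of X^N are the extensional functions on {..<N}. This makes X^N the topspace of the
   product topology and, for a Borel measure mu on X, the space of the product measure. *)

abbreviation configs :: "nat \<Rightarrow> (nat \<Rightarrow> 'a) set" where
  "configs N \<equiv> PiE {..<N} (\<lambda>_. UNIV)"

definition config_dist :: "nat \<Rightarrow> (nat \<Rightarrow> 'a::metric_space) \<Rightarrow> (nat \<Rightarrow> 'a) \<Rightarrow> real" where
  "config_dist N x y = (1 / real N) * (\<Sum>i<N. dist (x i) (y i))"

definition particle_hamiltonian :: "nat \<Rightarrow> ((nat \<Rightarrow> 'a::metric_space) \<Rightarrow> real) \<Rightarrow> bool" where
  "particle_hamiltonian N h \<longleftrightarrow>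
     continuous_map (product_topology (\<lambda>_. euclidean) {..<N}) euclideanreal h \<and>
     (\<forall>x\<in>configs N. \<forall>p. p permutes {..<N} \<longrightarrow> h (x \<circ> p) = h x)"

definition equicontinuous_per_particle ::
    "(nat \<Rightarrow> (nat \<Rightarrow> 'a::metric_space) \<Rightarrow> real) \<Rightarrow> bool" where
  "equicontinuous_per_particle H \<longleftrightarrow>
     (\<forall>\<epsilon>>0. \<exists>\<delta>>0. \<forall>N\<ge>1. \<forall>x\<in>configs N. \<forall>y\<in>configs N.
        config_dist N x y \<le> \<delta> \<longrightarrow> \<bar>H N x - H N y\<bar> / real N \<le> \<epsilon>)"

abbreviation C0 :: "('a::metric_space \<Rightarrow> real) set" where
  "C0 \<equiv> {u. continuous_on UNIV u}"

definition min_energy ::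
    "(nat \<Rightarrow> (nat \<Rightarrow> 'a) \<Rightarrow> real) \<Rightarrow> ('a \<Rightarrow> real) \<Rightarrow> nat \<Rightarrow> real" where
  "min_energy H u N = (INF x\<in>configs N. (1 / real N) * (H N x + (\<Sum>i<N. u (x i))))"

(* Only meaningful for those u at which the limit exists. *)
definition limit_energy :: "(nat \<Rightarrow> (nat \<Rightarrow> 'a) \<Rightarrow> real) \<Rightarrow> ('a \<Rightarrow> real) \<Rightarrow> real" where
  "limit_energy H u = lim (min_energy H u)"

definition gateaux_differentiable_C0 :: "(('a::metric_space \<Rightarrow> real) \<Rightarrow> real) \<Rightarrow> bool" where
  "gateaux_differentiable_C0 F \<longleftrightarrow>
     (\<forall>u\<in>C0. \<forall>v\<in>C0. (\<lambda>t::real. F (\<lambda>x. u x + t * v x)) differentiable_on UNIV)"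

(* Extended-real valued, since the supremum is not a priori finite. *)
definition macro_energy ::
    "(nat \<Rightarrow> (nat \<Rightarrow> 'a::metric_space) \<Rightarrow> real) \<Rightarrow> 'a measure \<Rightarrow> ereal" where
  "macro_energy H \<mu> = (SUP u\<in>C0. ereal (limit_energy H u - (\<integral>x. u x \<partial>\<mu>)))"

end

theory Submission imports Defs begin

text \<open>
  Integrating the defining inequality of the infimum against \<open>\<mu>\<^sup>\<otimes>\<^sup>N\<close> shows that the mean energy is
  asymptotically at least \<open>E(\<mu>)\<close>.

  For the converse, fix finitely many continuous bump functions with disjoint supports of small
  diameter which together carry almost all the mass of \<open>\<mu>\<close>. On their span the limit functional is
  a differentiable function of finitely many variables, and, as in the Gaertner--Ellis theorem,
  differentiability forces the moments of near-minimizers to converge to the gradient. This yields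
  configurations x whose moments are close to those of \<open>\<mu>\<close> and whose energy per particle is at most
  \<open>E(\<mu>)\<close> up to a small error. By the law of large numbers a \<open>\<mu>\<^sup>\<otimes>\<^sup>N\<close>-typical configuration y has almost
  the same moments; permuting its coordinates matches almost every point of y with a point of x in
  the same bump, so that equicontinuity bounds the energy of y by that of x.
\<close>

section \<open>Permutations and oscillation\<close>

text \<open>Encodes a disjoint family as a partial labelling, with \<open>None\<close> for points
  outside every member, so that matching cell by cell becomes an equality of label
  multisets.\<close>

lemma label_of_disjoint_family:
  assumes "disjoint_family_on A J"
  shows "\<exists>l. \<forall>i j. l i = Some j \<longleftrightarrow> j \<in> J \<and> i \<in> A j"
proof -
  have uniq: "j = j'" if "j \<in> J" "j' \<in> J" "i \<in> A j" "i \<in> A j'" for i j j'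
    using assms that unfolding disjoint_family_on_def by blast
  have "\<exists>v. \<forall>j. v = Some j \<longleftrightarrow> j \<in> J \<and> i \<in> A j" for i
  proof (cases "\<exists>j\<in>J. i \<in> A j")
    case True
    then obtain j where "j \<in> J" "i \<in> A j" by blast
    then show ?thesis using uniq by (intro exI[of _ "Some j"]) auto
  next
    case False
    then show ?thesis by (intro exI[of _ None]) auto
  qed
  then show ?thesis by (intro choice allI)
qed

text \<open>Select exactly \<open>n j\<close> indices of \<open>x\<close> and of \<open>y\<close> in
  each cell \<open>U j\<close>. Since the selections have equal sizes, a permutation of the indices
  carries one to the other cell by cell. Matched pairs lie within distance \<open>r\<close>, and
  each unselected index costs at most \<open>D\<close> more.\<close>

lemma cell_matching_permutation:
  fixes x y :: "nat \<Rightarrow> 'a::metric_space" and U :: "'i \<Rightarrow> 'a set"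
  assumes J: "finite J" "disjoint_family_on U J"
    and diam: "\<And>j p q. j \<in> J \<Longrightarrow> p \<in> U j \<Longrightarrow> q \<in> U j \<Longrightarrow> dist p q \<le> r"
    and D: "\<And>p q :: 'a. dist p q \<le> D" and r: "0 \<le> r"
    and nx: "\<And>j. j \<in> J \<Longrightarrow> n j \<le> card {i. i < N \<and> x i \<in> U j}"
    and ny: "\<And>j. j \<in> J \<Longrightarrow> n j \<le> card {i. i < N \<and> y i \<in> U j}"
  obtains \<sigma> where "\<sigma> permutes {..<N}"
    and "(\<Sum>i<N. dist (x i) (y (\<sigma> i))) \<le> r * real N + D * (real N - (\<Sum>j\<in>J. real (n j)))"
proof -
  have sel: "\<exists>A. \<forall>j\<in>J. A j \<subseteq> {i. i < N \<and> z i \<in> U j} \<and> card (A j) = n j"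
    if "\<And>j. j \<in> J \<Longrightarrow> n j \<le> card {i. i < N \<and> z i \<in> U j}" for z :: "nat \<Rightarrow> 'a"
  proof (rule bchoice, rule ballI)
    fix j assume "j \<in> J"
    then have "n j \<le> card {i. i < N \<and> z i \<in> U j}" by (rule that)
    then show "\<exists>A. A \<subseteq> {i. i < N \<and> z i \<in> U j} \<and> card A = n j"
      by (rule obtain_subset_with_card_n) (intro exI conjI)
  qed
  obtain A where A: "\<And>j. j \<in> J \<Longrightarrow> A j \<subseteq> {i. i < N \<and> x i \<in> U j}" "\<And>j. j \<in> J \<Longrightarrow> card (A j) = n j"
  proof -
    have "\<exists>A. \<forall>j\<in>J. A j \<subseteq> {i. i < N \<and> x i \<in> U j} \<and> card (A j) = n j" by (rule sel[OF nx])
    then show ?thesis using that by blast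
  qed
  obtain B where B: "\<And>j. j \<in> J \<Longrightarrow> B j \<subseteq> {i. i < N \<and> y i \<in> U j}" "\<And>j. j \<in> J \<Longrightarrow> card (B j) = n j"
  proof -
    have "\<exists>B. \<forall>j\<in>J. B j \<subseteq> {i. i < N \<and> y i \<in> U j} \<and> card (B j) = n j" by (rule sel[OF ny])
    then show ?thesis using that by blast
  qed
  have disA: "disjoint_family_on A J" and disB: "disjoint_family_on B J"
    using A(1) B(1) J(2) unfolding disjoint_family_on_def by blast+
  have fin: "finite (A j)" "finite (B j)" if "j \<in> J" for j
    using finite_subset[OF A(1)[OF that]] finite_subset[OF B(1)[OF that]] by auto
  have cardA: "card (\<Union>j\<in>J. A j) = (\<Sum>j\<in>J. n j)" and cardB: "card (\<Union>j\<in>J. B j) = (\<Sum>j\<in>J. n j)"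
    using card_UN_disjoint'[OF disA fin(1) J(1)] card_UN_disjoint'[OF disB fin(2) J(1)] A(2) B(2)
    by simp_all
  have subA: "(\<Union>j\<in>J. A j) \<subseteq> {..<N}" and subB: "(\<Union>j\<in>J. B j) \<subseteq> {..<N}"
    using A(1) B(1) by blast+
  obtain l where l: "\<And>i j. l i = Some j \<longleftrightarrow> j \<in> J \<and> i \<in> A j"
    using label_of_disjoint_family[OF disA] by blast
  obtain l' where l': "\<And>i j. l' i = Some j \<longleftrightarrow> j \<in> J \<and> i \<in> B j"
    using label_of_disjoint_family[OF disB] by blast
  have none: "l i = None \<longleftrightarrow> i \<notin> (\<Union>j\<in>J. A j)" "l' i = None \<longleftrightarrow> i \<notin> (\<Union>j\<in>J. B j)" for i
    using l[of i] l'[of i] by (metis (no_types, lifting) UN_iff not_Some_eq)+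
  \<comment> \<open>The unselected indices form the class of \<open>None\<close>; both sides have
    equally many of them because both selections have the same total size.\<close>
  have cards: "card {i \<in> {..<N}. l i = v} = card {i \<in> {..<N}. l' i = v}" for v
  proof (cases v)
    case None
    have "{i \<in> {..<N}. l i = v} = {..<N} - (\<Union>j\<in>J. A j)"
      "{i \<in> {..<N}. l' i = v} = {..<N} - (\<Union>j\<in>J. B j)"
      using None none by auto
    then show ?thesis
      using cardA cardB subA subB by (simp add: card_Diff_subset finite_subset)
  next
    case (Some j)
    show ?thesis
    proof (cases "j \<in> J")
      case True
      then have "{i \<in> {..<N}. l i = v} = A j" "{i \<in> {..<N}. l' i = v} = B j"
        using Some l l' A(1)[OF True] B(1)[OF True] True by auto
      then show ?thesis using A(2) B(2) True by simp
    next
      case False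
      then have "{i \<in> {..<N}. l i = v} = {}" "{i \<in> {..<N}. l' i = v} = {}"
        using Some l l' by auto
      then show ?thesis by (simp only: card.empty)
    qed
  qed
  \<comment> \<open>Equal class sizes mean equal multisets of labels, and such an equality is
    realized by a permutation of the indices.\<close>
  have "image_mset l (mset_set {..<N}) = image_mset l' (mset_set {..<N})"
    by (rule multiset_eqI)
       (use cards in \<open>simp add: count_image_mset' eq_commute[of _ "l _"] eq_commute[of _ "l' _"] conj_commute\<close>)
  then obtain \<sigma> where \<sigma>: "\<sigma> permutes {..<N}" "\<forall>i\<in>{..<N}. l i = l' (\<sigma> i)"
    using image_mset_eq_implies_permutes[of "{..<N}" l l'] by auto
  have pt: "dist (x i) (y (\<sigma> i)) \<le> r + (if i \<in> (\<Union>j\<in>J. A j) then 0 else D)" if "i < N" for i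
  proof (cases "i \<in> (\<Union>j\<in>J. A j)")
    case True
    then obtain j where j: "j \<in> J" "i \<in> A j" by blast
    then have "\<sigma> i \<in> B j" using l l' \<sigma>(2) that by (metis lessThan_iff)
    then show ?thesis using diam[OF j(1)] A(1)[OF j(1)] B(1)[OF j(1)] j True by auto
  next
    case False
    then show ?thesis using D[of "x i" "y (\<sigma> i)"] r by simp
  qed
  have "(\<Sum>i<N. dist (x i) (y (\<sigma> i))) \<le> (\<Sum>i<N. r + (if i \<in> (\<Union>j\<in>J. A j) then 0 else D))"
    by (rule sum_mono) (use pt in auto)
  also have "\<dots> = r * real N + (\<Sum>i\<in>{..<N} - (\<Union>j\<in>J. A j). D)"
  proof -
    have "(\<Sum>i<N. if i \<in> (\<Union>j\<in>J. A j) then 0 else D) = (\<Sum>i\<in>{..<N} - (\<Union>j\<in>J. A j). D)"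
      by (rule sum.mono_neutral_cong_right) auto
    then show ?thesis by (simp add: sum.distrib)
  qed
  also have "\<dots> = r * real N + D * (real N - (\<Sum>j\<in>J. real (n j)))"
  proof -
    have "card (\<Union>j\<in>J. A j) \<le> N" using card_mono[OF _ subA] by simp
    then have "real (card ({..<N} - (\<Union>j\<in>J. A j))) = real N - (\<Sum>j\<in>J. real (n j))"
      using cardA subA by (simp add: card_Diff_subset finite_subset of_nat_diff)
    then show ?thesis by simp
  qed
  finally show ?thesis using that \<sigma>(1) by blast
qed

section \<open>Bounded oscillation of the energy per particle\<close>

lemma card_residue_class_le:
  assumes "M > 0"
  shows "card {i. i < N \<and> i mod M = c} \<le> N div M + 1"
proof -
  have "inj_on (\<lambda>i. i div M) {i. i < N \<and> i mod M = c}"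
    by (rule inj_onI) (metis (mono_tags, lifting) div_mult_mod_eq mem_Collect_eq)
  moreover have "(\<lambda>i. i div M) ` {i. i < N \<and> i mod M = c} \<subseteq> {..N div M}"
    by (auto intro: div_le_mono)
  ultimately show ?thesis
    using card_inj_on_le[of "\<lambda>i. i div M" _ "{..N div M}"] by simp
qed

text \<open>Since X need not be connected, one cannot chain inside X; instead the coordinates are
  changed one residue class modulo M at a time, each class carrying a fraction 1/M of the mass.\<close>

lemma equicontinuous_per_particle_oscillation:
  fixes H :: "nat \<Rightarrow> (nat \<Rightarrow> 'a::metric_space) \<Rightarrow> real"
  assumes "equicontinuous_per_particle H" and D: "\<And>p q :: 'a. dist p q \<le> D"
  obtains C where "C \<ge> 0" and "\<forall>\<^sub>F N in sequentially. \<forall>x\<in>configs N. \<forall>y\<in>configs N.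
    \<bar>H N x - H N y\<bar> / real N \<le> C"
proof -
  obtain \<delta> where \<delta>: "\<delta> > 0" "\<And>N x y. N \<ge> 1 \<Longrightarrow> x \<in> configs N \<Longrightarrow> y \<in> configs N \<Longrightarrow>
      config_dist N x y \<le> \<delta> \<Longrightarrow> \<bar>H N x - H N y\<bar> / real N \<le> 1"
    using assms(1)[unfolded equicontinuous_per_particle_def, rule_format, of 1] by auto
  have D0: "D \<ge> 0" using D[of undefined undefined] by simp
  \<comment> \<open>Switching one residue class moves at most \<open>2 * N / M\<close> coordinates,
    each by at most \<open>D\<close>. The choice of \<open>M\<close> keeps the resulting
    \<open>config_dist\<close>, at most \<open>2 * D / M\<close>, within
    \<open>\<delta>\<close>.\<close>
  obtain M0 :: nat where M0: "2 * D / \<delta> < real M0" using reals_Archimedean2 by blast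
  define M where "M = M0 + 1"
  have M: "M > 0" "2 * D \<le> \<delta> * real M"
    using M0 \<delta>(1) unfolding M_def by (auto simp: field_simps)
  have "\<bar>H N x - H N y\<bar> / real N \<le> real M"
    if N: "N \<ge> M" and x: "x \<in> configs N" and y: "y \<in> configs N" for N x y
  proof -
    \<comment> \<open>\<open>z c\<close> has switched from \<open>x\<close> to \<open>y\<close> in
      the residue classes below \<open>c\<close>; consecutive configurations differ in one class
      only.\<close>
    define z where "z c = (\<lambda>i\<in>{..<N}. if i mod M < c then y i else x i)" for c
    have zc: "z c \<in> configs N" for c unfolding z_def by simp
    have z0: "z 0 = x" and zM: "z M = y"
      unfolding z_def using x y M by (auto simp: fun_eq_iff PiE_def extensional_def)
    have step: "\<bar>H N (z c) - H N (z (Suc c))\<bar> / real N \<le> 1" for c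
    proof (rule \<delta>(2)[OF _ zc zc])
      show "1 \<le> N" using N M by linarith
      have "(\<Sum>i<N. dist (z c i) (z (Suc c) i)) \<le> (\<Sum>i<N. if i mod M = c then D else 0)"
        by (rule sum_mono) (use D in \<open>auto simp: z_def less_Suc_eq\<close>)
      also have "\<dots> = real (card {i. i < N \<and> i mod M = c}) * D"
      proof -
        have "{..<N} \<inter> {i. i mod M = c} = {i. i < N \<and> i mod M = c}" by auto
        then show ?thesis by (simp add: sum.If_cases)
      qed
      also have "\<dots> \<le> (2 * real N / real M) * D"
      proof (rule mult_right_mono[OF _ D0])
        \<comment> \<open>From \<open>N \<ge> M\<close> one gets \<open>N div M \<ge> 1\<close>, so
          the extra 1 in the class size is absorbed by doubling.\<close>
        have "N div M + 1 \<le> 2 * (N div M)" using N M(1) by (simp add: Suc_le_eq div_greater_zero_iff)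
        then have "real (card {i. i < N \<and> i mod M = c}) \<le> 2 * real (N div M)"
          using card_residue_class_le[OF M(1), of N c] by linarith
        also have "\<dots> \<le> 2 * (real N / real M)" using of_nat_div_le_of_nat[of N M, where ?'a = real] by simp
        finally show "real (card {i. i < N \<and> i mod M = c}) \<le> 2 * real N / real M" by simp
      qed
      also have "\<dots> \<le> real N * \<delta>"
      proof -
        have "2 * D / real M \<le> \<delta>" using M by (simp add: field_simps)
        from mult_left_mono[OF this, of "real N"] show ?thesis by (simp add: field_simps)
      qed
      finally show "config_dist N (z c) (z (Suc c)) \<le> \<delta>"
        unfolding config_dist_def using N M by (simp add: field_simps)
    qed
    have "\<bar>H N (z 0) - H N (z c)\<bar> / real N \<le> real c" for c
    proof (induction c)
      case (Suc c)
      have "\<bar>H N (z 0) - H N (z (Suc c))\<bar> / real N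
          \<le> (\<bar>H N (z 0) - H N (z c)\<bar> + \<bar>H N (z c) - H N (z (Suc c))\<bar>) / real N"
        by (intro divide_right_mono) auto
      then show ?case using Suc step[of c] by (simp add: add_divide_distrib)
    qed simp
    from this[of M] show ?thesis using z0 zM by simp
  qed
  then show ?thesis
    by (intro that[of "real M"] eventually_sequentiallyI[of M]) auto
qed

section \<open>Bump functions and empirical means\<close>

definition ramp :: "real \<Rightarrow> real" where
  "ramp t = max 0 (min 1 t)"

lemma ramp_bounds: "0 \<le> ramp t" "ramp t \<le> 1"
  by (auto simp: ramp_def)

lemma continuous_on_ramp [continuous_intros]: "continuous_on S f \<Longrightarrow> continuous_on S (\<lambda>x. ramp (f x))"
  unfolding ramp_def by (intro continuous_intros)

text \<open>Cover the space by finitely many balls of radius \<open>\<epsilon> / 2\<close> and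
  remove from each ball the earlier ones. The indicators of these sets sum to 1; they are pointwise
  limits of continuous bumps, and dominated convergence makes the total mass of the bumps exceed
  \<open>1 - \<epsilon>\<close> at some stage \<open>n\<close>.\<close>

lemma small_bumps_exist:
  fixes \<mu> :: "'a::metric_space measure"
  assumes "compact (UNIV :: 'a set)" and "prob_space \<mu>" and sets: "sets \<mu> = sets borel" and "\<epsilon> > 0"
  obtains k :: nat and \<phi> :: "nat \<Rightarrow> 'a \<Rightarrow> real"
  where "\<And>j. continuous_on UNIV (\<phi> j)" and "\<And>j x. 0 \<le> \<phi> j x" and "\<And>j x. \<phi> j x \<le> 1"
    and "disjoint_family_on (\<lambda>j. {x. \<phi> j x > 0}) {..<k}"
    and "\<And>j x y. \<phi> j x > 0 \<Longrightarrow> \<phi> j y > 0 \<Longrightarrow> dist x y \<le> \<epsilon>"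
    and "(\<Sum>j<k. \<integral>x. \<phi> j x \<partial>\<mu>) \<ge> 1 - \<epsilon>"
proof -
  interpret prob_space \<mu> by fact
  define r where "r = \<epsilon> / 2"
  have r: "r > 0" using \<open>\<epsilon> > 0\<close> by (simp add: r_def)
  obtain K where K: "finite K" "(UNIV :: 'a set) \<subseteq> (\<Union>p\<in>K. ball p r)"
    using assms(1) r unfolding compact_eq_totally_bounded by blast
  obtain ps where ps: "set ps = K" using finite_list[OF K(1)] by blast
  define k where "k = length ps"
  define d where "d j x = dist x (ps ! j)" for j x
  have cover: "\<exists>j<k. d j x < r" for x
    using K(2) ps unfolding k_def d_def by (force simp: in_set_conv_nth dist_commute)
  \<comment> \<open>The value 1 of \<open>n * (r - d j x)\<close> is the threshold: the bump is
    positive only where its own value exceeds 1 and all earlier values are below 1. Hence the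
    positivity sets are disjoint for every \<open>n\<close>, not just in the limit.\<close>
  define \<phi> where "\<phi> n j x = ramp (real n * (r - d j x) - 1) * (\<Prod>i<j. ramp (1 - real n * (r - d i x)))"
    for n j :: nat and x
  have cont: "continuous_on UNIV (\<phi> n j)" for n j
    unfolding \<phi>_def d_def by (intro continuous_intros)
  have ge0: "0 \<le> \<phi> n j x" for n j x
    unfolding \<phi>_def by (intro mult_nonneg_nonneg prod_nonneg ballI ramp_bounds)
  have le1: "\<phi> n j x \<le> 1" for n j x
    unfolding \<phi>_def by (intro mult_le_one prod_nonneg prod_le_1 ballI conjI ramp_bounds)
  have pos: "real n * (r - d j x) > 1" "\<And>i. i < j \<Longrightarrow> real n * (r - d i x) < 1" if "\<phi> n j x > 0" for n j x
  proof -
    have "ramp (real n * (r - d j x) - 1) \<noteq> 0" using that unfolding \<phi>_def by auto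
    then show "real n * (r - d j x) > 1" by (auto simp: ramp_def split: if_splits)
    show "real n * (r - d i x) < 1" if "i < j" for i
    proof -
      have "ramp (1 - real n * (r - d i x)) \<noteq> 0"
      proof
        assume "ramp (1 - real n * (r - d i x)) = 0"
        then have "(\<Prod>i<j. ramp (1 - real n * (r - d i x))) = 0"
          by (intro prod_zero) (use that in auto)
        then show False using \<open>\<phi> n j x > 0\<close> unfolding \<phi>_def by (simp only: mult_zero_right less_irrefl)
      qed
      then show ?thesis by (auto simp: ramp_def max_def min_def split: if_splits)
    qed
  qed
  have disj: "disjoint_family_on (\<lambda>j. {x. \<phi> n j x > 0}) {..<k}" for n
  proof -
    have "i = j" if "\<phi> n i x > 0" "\<phi> n j x > 0" for i j x
      using pos[OF that(1)] pos[OF that(2)] by (metis linorder_neqE_nat not_less_iff_gr_or_eq)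
    then show ?thesis unfolding disjoint_family_on_def by blast
  qed
  have diam: "dist x y \<le> \<epsilon>" if "\<phi> n j x > 0" "\<phi> n j y > 0" for n j x y
  proof -
    have "real n * (r - d j x) > 0" "real n * (r - d j y) > 0" using pos[OF that(1)] pos[OF that(2)] by linarith+
    then have "d j x < r" "d j y < r" by (auto simp: zero_less_mult_iff)
    then show ?thesis using dist_triangle2[of x y "ps ! j"] unfolding d_def r_def by linarith
  qed
  have le_one: "(\<Sum>j<k. \<phi> n j x) \<le> 1" for n x
  proof (cases "\<exists>j<k. \<phi> n j x > 0")
    case True
    then obtain j where j: "j < k" "\<phi> n j x > 0" by blast
    have "\<phi> n i x = 0" if "i \<in> {..<k} - {j}" for i
      using disj[of n] j that ge0[of n i x] unfolding disjoint_family_on_def by force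
    then have "(\<Sum>j<k. \<phi> n j x) = \<phi> n j x"
      using j by (subst sum.remove[of _ j]) auto
    then show ?thesis using le1 by simp
  next
    case False
    then have "\<phi> n j x = 0" if "j < k" for j using that ge0[of n j x] by force
    then show ?thesis by simp
  qed
  have lim: "(\<lambda>n. \<Sum>j<k. \<phi> n j x) \<longlonglongrightarrow> 1" for x
  proof -
    \<comment> \<open>The first ball containing \<open>x\<close> carries the limit: its own ramp is
      eventually 1, and earlier balls do not contain \<open>x\<close>, so their factors equal
      1.\<close>
    define j where "j = (LEAST j. d j x < r)"
    have j: "d j x < r" and jk: "j < k"
      using cover[of x] LeastI[of "\<lambda>j. d j x < r"] Least_le[of "\<lambda>j. d j x < r"]
      unfolding j_def by (auto intro: le_less_trans)
    have small: "r \<le> d i x" if "i < j" for i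
      using not_less_Least[of i "\<lambda>j. d j x < r"] that unfolding j_def by auto
    obtain n0 :: nat where n0: "2 / (r - d j x) < real n0" using reals_Archimedean2 by blast
    have "(\<Sum>j<k. \<phi> n j x) = 1" if "n \<ge> n0" for n
    proof -
      have "2 / (r - d j x) \<le> real n" using n0 that by linarith
      then have "2 \<le> real n * (r - d j x)" using j by (simp add: field_simps)
      moreover have "ramp (1 - real n * (r - d i x)) = 1" if "i < j" for i
      proof -
        have "real n * (r - d i x) \<le> 0" using small[OF that] by (simp add: mult_nonneg_nonpos)
        then show ?thesis by (simp add: ramp_def)
      qed
      ultimately have "\<phi> n j x = 1" unfolding \<phi>_def by (simp add: ramp_def)
      moreover have "\<phi> n j x \<le> (\<Sum>j<k. \<phi> n j x)"
        by (rule member_le_sum) (use jk ge0 in auto)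
      ultimately show ?thesis using le_one[of n x] by simp
    qed
    then show ?thesis
      by (intro tendsto_eventually eventually_sequentiallyI)
  qed
  have meas: "\<phi> n j \<in> borel_measurable \<mu>" for n j
    using borel_measurable_continuous_onI[OF cont] measurable_cong_sets[OF sets refl] by blast
  have int: "integrable \<mu> (\<phi> n j)" for n j
    by (rule integrable_const_bound[where B=1]) (use meas ge0 le1 in auto)
  have "(\<lambda>n. \<integral>x. (\<Sum>j<k. \<phi> n j x) \<partial>\<mu>) \<longlonglongrightarrow> (\<integral>x. 1 \<partial>\<mu>)"
    by (rule integral_dominated_convergence[where w = "\<lambda>_. 1"])
       (use meas lim le_one ge0 in \<open>auto simp: sum_nonneg\<close>)
  then have "(\<lambda>n. \<Sum>j<k. \<integral>x. \<phi> n j x \<partial>\<mu>) \<longlonglongrightarrow> 1"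
    using int prob_space by simp
  then have "\<forall>\<^sub>F n in sequentially. (\<Sum>j<k. \<integral>x. \<phi> n j x \<partial>\<mu>) > 1 - \<epsilon>"
    by (rule order_tendstoD) (use \<open>\<epsilon> > 0\<close> in auto)
  then obtain n where "(\<Sum>j<k. \<integral>x. \<phi> n j x \<partial>\<mu>) > 1 - \<epsilon>"
    using eventually_happens'[OF sequentially_bot] by blast
  then show ?thesis
    by (intro that[of "\<phi> n" k]) (use cont ge0 le1 disj diam in \<open>auto intro: less_imp_le\<close>)
qed

section \<open>Measurability, means and variances under the product measure\<close>

definition emp_mean :: "nat \<Rightarrow> ('a \<Rightarrow> real) \<Rightarrow> (nat \<Rightarrow> 'a) \<Rightarrow> real" where
  "emp_mean N f x = (1 / real N) * (\<Sum>i<N. f (x i))"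

text \<open>Round every coordinate to a point of a finite net, chosen measurably. The rounded
  function depends only on finitely many discrete labels, hence is measurable, and continuity makes
  \<open>h\<close> the pointwise limit as the nets are refined. This avoids comparing the product
  sigma-algebra with the Borel sets of the product topology.\<close>

lemma borel_measurable_of_config_continuity:
  fixes h :: "(nat \<Rightarrow> 'a::metric_space) \<Rightarrow> real" and \<mu> :: "'a measure"
  assumes "compact (UNIV :: 'a set)" and sets: "sets \<mu> = sets borel"
    and cont: "\<And>\<epsilon>. \<epsilon> > 0 \<Longrightarrow> \<exists>\<delta>>0. \<forall>x\<in>configs N. \<forall>y\<in>configs N. config_dist N x y \<le> \<delta> \<longrightarrow> \<bar>h x - h y\<bar> \<le> \<epsilon>"
  shows "h \<in> borel_measurable (PiM {..<N} (\<lambda>_. \<mu>))"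
proof -
  have "\<exists>ps. \<forall>x::'a. \<exists>j::nat. dist x (ps j) < 1 / real (Suc n)" for n
  proof -
    obtain K where K: "finite K" "(UNIV :: 'a set) \<subseteq> (\<Union>p\<in>K. ball p (1 / real (Suc n)))"
      using assms(1) unfolding compact_eq_totally_bounded
      by (meson of_nat_0_less_iff zero_less_Suc zero_less_divide_1_iff)
    obtain ps where ps: "set ps = K" using finite_list[OF K(1)] by blast
    have "\<exists>j. dist x (ps ! j) < 1 / real (Suc n)" for x
      using K(2) ps by (force simp: in_set_conv_nth dist_commute)
    then show ?thesis by blast
  qed
  then obtain ps where ps: "\<And>n x. \<exists>j::nat. dist (x::'a) (ps n j) < 1 / real (Suc n)"
    by metis
  \<comment> \<open>Taking the least admissible index makes the choice of a net point measurable,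
    since the admissibility conditions are open balls.\<close>
  define lab where "lab n x = (LEAST j. dist x (ps n j) < 1 / real (Suc n))" for n and x :: 'a
  have lab_dist: "dist x (ps n (lab n x)) < 1 / real (Suc n)" for n x
    unfolding lab_def by (rule LeastI_ex) (rule ps)
  have "lab n \<in> borel \<rightarrow>\<^sub>M count_space UNIV" for n
  proof -
    have "Measurable.pred borel (\<lambda>x::'a. dist x (ps n j) < 1 / real (Suc n))" for j
    proof -
      have "{x::'a. dist x (ps n j) < 1 / real (Suc n)} = ball (ps n j) (1 / real (Suc n))"
        by (auto simp: dist_commute)
      then show ?thesis by (simp add: pred_def)
    qed
    then show ?thesis unfolding lab_def by (rule measurable_Least)
  qed
  then have lab_meas: "lab n \<in> \<mu> \<rightarrow>\<^sub>M count_space UNIV" for n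
    using measurable_cong_sets[OF sets refl] by blast
  \<comment> \<open>The rounded function factors through the labels \<open>z n x\<close>. On the
    finite product of discrete spaces every function is measurable, so no regularity of
    \<open>g n\<close> is required.\<close>
  define g where "g n w = h (\<lambda>i\<in>{..<N}. ps n (w i))" for n and w :: "nat \<Rightarrow> nat"
  define z where "z n x = (\<lambda>i\<in>{..<N}. lab n (x i))" for n and x :: "nat \<Rightarrow> 'a"
  have "(\<lambda>x. g n (z n x)) \<in> borel_measurable (PiM {..<N} (\<lambda>_. \<mu>))" for n
  proof (rule measurable_compose[where f = "z n" and g = "g n" and N = "PiM {..<N} (\<lambda>_. count_space UNIV)"])
    show "z n \<in> PiM {..<N} (\<lambda>_. \<mu>) \<rightarrow>\<^sub>M PiM {..<N} (\<lambda>_. count_space UNIV)"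
      unfolding z_def using lab_meas by (intro measurable_restrict measurable_PiM_component_rev) auto
    show "g n \<in> borel_measurable (PiM {..<N} (\<lambda>_. count_space UNIV))"
      by (subst count_space_PiM_finite) auto
  qed
  moreover have "(\<lambda>n. g n (z n x)) \<longlonglongrightarrow> h x" if "x \<in> space (PiM {..<N} (\<lambda>_. \<mu>))" for x
  proof -
    have x: "x \<in> configs N"
      using that sets_eq_imp_space_eq[OF sets] by (simp add: space_PiM)
    show ?thesis
    proof (rule LIMSEQ_I)
      fix \<epsilon> :: real assume "\<epsilon> > 0"
      then obtain \<delta> where \<delta>: "\<delta> > 0" "\<And>x y. x \<in> configs N \<Longrightarrow> y \<in> configs N \<Longrightarrow>
          config_dist N x y \<le> \<delta> \<Longrightarrow> \<bar>h x - h y\<bar> \<le> \<epsilon> / 2"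
        using cont[of "\<epsilon> / 2"] by auto
      obtain n0 where n0: "1 / real (Suc n0) < \<delta>"
        using \<delta>(1) nat_approx_posE by blast
      have "norm (g n (z n x) - h x) < \<epsilon>" if "n \<ge> n0" for n
      proof -
        have small: "1 / real (Suc n) \<le> 1 / real (Suc n0)" using that by (simp add: frac_le)
        have "config_dist N (\<lambda>i\<in>{..<N}. ps n (z n x i)) x \<le> (1 / real N) * (\<Sum>i<N. \<delta>)"
          unfolding config_dist_def z_def
          using lab_dist[of _ n] small n0
          by (intro mult_left_mono sum_mono) (auto simp: dist_commute intro!: less_imp_le dest: less_trans intro: less_le_trans le_less_trans)
        also have "\<dots> \<le> \<delta>" using \<delta>(1) by simp
        finally have "\<bar>g n (z n x) - h x\<bar> \<le> \<epsilon> / 2"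
          unfolding g_def by (intro \<delta>(2)) (use x in auto)
        then show ?thesis using \<open>\<epsilon> > 0\<close> by simp
      qed
      then show "\<exists>n0. \<forall>n\<ge>n0. norm (g n (z n x) - h x) < \<epsilon>" by blast
    qed
  qed
  ultimately show ?thesis by (rule borel_measurable_LIMSEQ_metric)
qed

lemma integral_emp_mean:
  fixes \<mu> :: "'a measure" and f :: "'a \<Rightarrow> real"
  assumes "prob_space \<mu>" and "N \<ge> 1" and "integrable \<mu> f"
  shows "integrable (PiM {..<N} (\<lambda>_. \<mu>)) (emp_mean N f)"
    and "(\<integral>x. emp_mean N f x \<partial>PiM {..<N} (\<lambda>_. \<mu>)) = (\<integral>x. f x \<partial>\<mu>)"
proof -
  have comp: "distr (PiM {..<N} (\<lambda>_. \<mu>)) \<mu> (\<lambda>x. x i) = \<mu>" if "i < N" for i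
    using distr_PiM_component[of "{..<N}" "\<lambda>_. \<mu>" i] assms(1) that by simp
  have int: "integrable (PiM {..<N} (\<lambda>_. \<mu>)) (\<lambda>x. f (x i))" if "i < N" for i
  proof -
    have "integrable (distr (PiM {..<N} (\<lambda>_. \<mu>)) \<mu> (\<lambda>x. x i)) f" using assms(3) comp[OF that] by simp
    then show ?thesis by (rule integrable_distr[rotated]) (use that in simp)
  qed
  have eq: "(\<integral>x. f (x i) \<partial>PiM {..<N} (\<lambda>_. \<mu>)) = (\<integral>x. f x \<partial>\<mu>)" if "i < N" for i
    using integral_distr[of "\<lambda>x. x i" "PiM {..<N} (\<lambda>_. \<mu>)" \<mu> f] comp[OF that] assms(3) that by simp
  show "integrable (PiM {..<N} (\<lambda>_. \<mu>)) (emp_mean N f)"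
    unfolding emp_mean_def using int by (intro integrable_mult_right Bochner_Integration.integrable_sum) auto
  have "(\<integral>x. emp_mean N f x \<partial>PiM {..<N} (\<lambda>_. \<mu>)) = (1 / real N) * (\<Sum>i<N. \<integral>x. f (x i) \<partial>PiM {..<N} (\<lambda>_. \<mu>))"
    unfolding emp_mean_def using int by simp
  also have "\<dots> = (\<integral>x. f x \<partial>\<mu>)" using eq assms(2) by simp
  finally show "(\<integral>x. emp_mean N f x \<partial>PiM {..<N} (\<lambda>_. \<mu>)) = (\<integral>x. f x \<partial>\<mu>)" .
qed

text \<open>Independence kills the off-diagonal terms of the expanded square, leaving
  \<open>N\<close> diagonal terms, each at most 1, under the factor \<open>1 / N\<^sup>2\<close>.
  This is the quantitative law of large numbers for the bumps.\<close>

lemma emp_mean_variance_le: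
  fixes \<mu> :: "'a measure" and f :: "'a \<Rightarrow> real"
  assumes "prob_space \<mu>" and "N \<ge> 1" and f: "f \<in> borel_measurable \<mu>" "\<And>x. 0 \<le> f x" "\<And>x. f x \<le> 1"
  defines "m \<equiv> \<integral>x. f x \<partial>\<mu>"
  shows "integrable (PiM {..<N} (\<lambda>_. \<mu>)) (\<lambda>x. (emp_mean N f x - m)\<^sup>2)"
    and "(\<integral>x. (emp_mean N f x - m)\<^sup>2 \<partial>PiM {..<N} (\<lambda>_. \<mu>)) \<le> 1 / real N"
proof -
  interpret prob_space \<mu> by fact
  interpret P: prob_space "PiM {..<N} (\<lambda>_. \<mu>)" by (rule prob_space_PiM) (rule assms(1))
  interpret Q: product_sigma_finite "\<lambda>_::nat. \<mu>"
    by unfold_locales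
  define g where "g x = f x - m" for x
  have intf: "integrable \<mu> f"
    by (rule integrable_const_bound[where B=1]) (use f in auto)
  have m: "0 \<le> m" "m \<le> 1"
    unfolding m_def using integral_ge_const[OF intf, of 0] integral_le_const[OF intf, of 1] f by auto
  have gb: "\<bar>g x\<bar> \<le> 1" for x unfolding g_def using f(2,3)[of x] m by linarith
  have gm [measurable]: "g \<in> borel_measurable \<mu>" unfolding g_def using f(1) by simp
  have intg: "integrable \<mu> g" and zero: "(\<integral>x. g x \<partial>\<mu>) = 0"
    unfolding g_def using intf by (auto simp: m_def prob_space)
  have ggb: "\<bar>g x * g y\<bar> \<le> 1" for x y
    using gb[of x] gb[of y] by (simp add: abs_mult mult_le_one)
  have int2: "integrable (PiM {..<N} (\<lambda>_. \<mu>)) (\<lambda>x. g (x i) * g (x l))" if "i < N" "l < N" for i l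
    by (rule P.integrable_const_bound[where B=1]) (use that ggb in auto)
  have cross: "(\<integral>x. g (x i) * g (x l) \<partial>PiM {..<N} (\<lambda>_. \<mu>)) = 0" if "i < N" "l < N" "i \<noteq> l" for i l
  proof -
    \<comment> \<open>Padding with constant factors 1 writes the two-coordinate product as a product
      over all coordinates, to which the product formula for integrals applies.\<close>
    define q where "q j t = (if j = i then g t else 1) * (if j = l then g t else 1)" for j :: nat and t
    have "(\<integral>x. g (x i) * g (x l) \<partial>PiM {..<N} (\<lambda>_. \<mu>)) = (\<integral>x. (\<Prod>j<N. q j (x j)) \<partial>PiM {..<N} (\<lambda>_. \<mu>))"
      unfolding q_def prod.distrib using that by simp
    also have "\<dots> = (\<Prod>j<N. \<integral>t. q j t \<partial>\<mu>)"
    proof (rule Q.product_integral_prod)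
      show "integrable \<mu> (q j)" for j
        by (cases "j = i"; cases "j = l") (use intg that in \<open>auto simp: q_def[abs_def]\<close>)
    qed simp
    also have "\<dots> = 0"
      by (rule prod_zero) (use that zero in \<open>auto simp: q_def intro!: bexI[of _ i]\<close>)
    finally show ?thesis .
  qed
  have diag: "(\<integral>x. g (x i) * g (x i) \<partial>PiM {..<N} (\<lambda>_. \<mu>)) \<le> 1" if "i < N" for i
    by (rule P.integral_le_const[OF int2[OF that that]]) (use ggb abs_le_D1 in blast)
  have sq: "(emp_mean N f x - m)\<^sup>2 = (1 / (real N)\<^sup>2) * (\<Sum>i<N. \<Sum>l<N. g (x i) * g (x l))" for x
  proof -
    have "emp_mean N f x - m = (1 / real N) * (\<Sum>i<N. g (x i))"
      unfolding emp_mean_def g_def using assms(2) by (simp add: sum_subtractf field_simps)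
    then show ?thesis
      by (simp add: power2_eq_square sum_product)
  qed
  show "integrable (PiM {..<N} (\<lambda>_. \<mu>)) (\<lambda>x. (emp_mean N f x - m)\<^sup>2)"
    unfolding sq using int2 by (intro integrable_mult_right Bochner_Integration.integrable_sum) auto
  have "(\<integral>x. (\<Sum>i<N. \<Sum>l<N. g (x i) * g (x l)) \<partial>PiM {..<N} (\<lambda>_. \<mu>))
      = (\<Sum>i<N. \<integral>x. (\<Sum>l<N. g (x i) * g (x l)) \<partial>PiM {..<N} (\<lambda>_. \<mu>))"
    by (rule Bochner_Integration.integral_sum) (use int2 in \<open>auto intro!: Bochner_Integration.integrable_sum\<close>)
  also have "\<dots> = (\<Sum>i<N. \<Sum>l<N. \<integral>x. g (x i) * g (x l) \<partial>PiM {..<N} (\<lambda>_. \<mu>))"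
    by (intro sum.cong refl Bochner_Integration.integral_sum) (use int2 in auto)
  finally have "(\<integral>x. (emp_mean N f x - m)\<^sup>2 \<partial>PiM {..<N} (\<lambda>_. \<mu>))
      = (1 / (real N)\<^sup>2) * (\<Sum>i<N. \<Sum>l<N. \<integral>x. g (x i) * g (x l) \<partial>PiM {..<N} (\<lambda>_. \<mu>))"
    unfolding sq by simp
  also have "\<dots> \<le> (1 / (real N)\<^sup>2) * (\<Sum>i<N. \<Sum>l<N. if l = i then 1 else 0)"
    by (intro mult_left_mono sum_mono) (use cross diag in auto)
  also have "\<dots> = 1 / real N"
    using assms(2) by (simp add: power2_eq_square)
  finally show "(\<integral>x. (emp_mean N f x - m)\<^sup>2 \<partial>PiM {..<N} (\<lambda>_. \<mu>)) \<le> 1 / real N" .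
qed

section \<open>Legendre duality for finitely many moments\<close>

text \<open>The quadratic penalty is coercive because the unpenalized part is bounded above: outside
  a large cube \<open>\<Phi>\<close> stays below its value at zero. Inside the cube, continuity of
  \<open>G\<close> from the Lipschitz bound and compactness by Tychonoff give a maximum.\<close>

lemma penalized_maximum_exists:
  fixes G :: "('i \<Rightarrow> real) \<Rightarrow> real" and m :: "'i \<Rightarrow> real"
  assumes J: "finite J" and lip: "\<And>a b. \<bar>G a - G b\<bar> \<le> (\<Sum>j\<in>J. \<bar>a j - b j\<bar>)"
    and bound: "\<And>a. G a - (\<Sum>j\<in>J. a j * m j) \<le> C" and \<tau>: "\<tau> > 0"
  defines "\<Phi> \<equiv> \<lambda>a. G a - (\<Sum>j\<in>J. a j * m j) - \<tau> / 2 * (\<Sum>j\<in>J. (a j)\<^sup>2)"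
  shows "\<exists>a. \<forall>b. \<Phi> b \<le> \<Phi> a"
proof -
  \<comment> \<open>With this choice \<open>\<tau> / 2 * R\<close> exceeds
    \<open>C - \<Phi> (\<lambda>_. 0)\<close>. The added 1 ensures \<open>R \<ge> 1\<close>, so a
    coordinate with \<open>\<bar>b j\<bar> > R\<close> already contributes at least \<open>R\<close>
    to the sum of squares.\<close>
  define R where "R = 2 * (C - \<Phi> (\<lambda>_. 0)) / \<tau> + 1"
  have C: "\<Phi> (\<lambda>_. 0) \<le> C" using bound[of "\<lambda>_. 0"] by (simp add: \<Phi>_def)
  have R: "R \<ge> 1" using C \<tau> by (simp add: R_def)
  have contG: "continuous_on UNIV G"
  proof -
    have "(G \<longlongrightarrow> G a) (at a)" for a
    proof -
      have coord: "((\<lambda>b. b j) \<longlongrightarrow> a j) (at a)" for j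
      proof -
        have "continuous_on UNIV (\<lambda>b::'i \<Rightarrow> real. b j)" by (rule continuous_on_product_coordinates)
        then show ?thesis by (simp add: continuous_on_def)
      qed
      have "((\<lambda>b. \<Sum>j\<in>J. \<bar>b j - a j\<bar>) \<longlongrightarrow> (\<Sum>j\<in>J. \<bar>a j - a j\<bar>)) (at a)"
        by (intro tendsto_sum tendsto_rabs tendsto_diff coord tendsto_const)
      then have "((\<lambda>b. G b - G a) \<longlongrightarrow> 0) (at a)"
        using lip by (intro Lim_null_comparison[where g = "\<lambda>b. \<Sum>j\<in>J. \<bar>b j - a j\<bar>" and f = "\<lambda>b. G b - G a"]) auto
      then show ?thesis by (simp add: Lim_null[symmetric])
    qed
    then show ?thesis by (simp add: continuous_on_def)
  qed
  have cont: "continuous_on (PiE UNIV (\<lambda>_. {-R..R})) \<Phi>"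
    unfolding \<Phi>_def
    by (intro continuous_intros continuous_on_subset[OF contG] continuous_on_subset[OF continuous_on_product_coordinates]) auto
  have comp: "compact (PiE (UNIV :: 'i set) (\<lambda>_. {-R..R}))"
  proof -
    have "compactin (product_topology (\<lambda>_. euclideanreal) (UNIV :: 'i set)) (PiE UNIV (\<lambda>_. {-R..R}))"
      by (subst compactin_PiE) simp
    then show ?thesis by (simp add: euclidean_product_topology)
  qed
  have zero: "(\<lambda>_. 0) \<in> PiE (UNIV :: 'i set) (\<lambda>_. {-R..R})" using R by auto
  obtain a where a: "\<And>b. b \<in> PiE UNIV (\<lambda>_. {-R..R}) \<Longrightarrow> \<Phi> b \<le> \<Phi> a"
    using continuous_attains_sup[OF comp _ cont] zero by blast
  have "\<Phi> b \<le> \<Phi> a" for b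
  proof (cases "\<forall>j\<in>J. \<bar>b j\<bar> \<le> R")
    case True
    \<comment> \<open>The cube restricts all coordinates, while \<open>b\<close> is controlled only
      on \<open>J\<close>. Zeroing the others leaves \<open>\<Phi>\<close> unchanged, because the
      Lipschitz bound sees only coordinates in \<open>J\<close>.\<close>
    define b' where "b' j = (if j \<in> J then b j else 0)" for j
    have "b' \<in> PiE UNIV (\<lambda>_. {-R..R})" using True R unfolding b'_def by (fastforce simp: abs_le_iff)
    moreover have "G b = G b'" using lip[of b b'] by (simp add: b'_def)
    then have "\<Phi> b = \<Phi> b'" unfolding \<Phi>_def b'_def by simp
    ultimately show ?thesis using a by simp
  next
    case False
    then obtain j where j: "j \<in> J" "R < \<bar>b j\<bar>" by force
    have "R * 1 \<le> \<bar>b j\<bar> * \<bar>b j\<bar>" using j R by (intro mult_mono) auto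
    also have "\<dots> = (b j)\<^sup>2" by (simp add: power2_eq_square)
    also have "\<dots> \<le> (\<Sum>j\<in>J. (b j)\<^sup>2)" using J j by (intro member_le_sum) auto
    finally have "\<tau> / 2 * R \<le> \<tau> / 2 * (\<Sum>j\<in>J. (b j)\<^sup>2)" using \<tau> by (intro mult_left_mono) auto
    moreover have "\<tau> / 2 * R = C - \<Phi> (\<lambda>_. 0) + \<tau> / 2" using \<tau> by (simp add: R_def field_simps)
    ultimately have "\<Phi> b \<le> \<Phi> (\<lambda>_. 0)" using bound[of b] \<tau> unfolding \<Phi>_def by linarith
    also have "\<dots> \<le> \<Phi> a" by (rule a[OF zero])
    finally show ?thesis .
  qed
  then show ?thesis by blast
qed

section \<open>The limit functional and near-minimizers\<close>

locale convergent_particle_system =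
  fixes H :: "nat \<Rightarrow> (nat \<Rightarrow> 'a::metric_space) \<Rightarrow> real"
  assumes compact: "compact (UNIV :: 'a set)"
    and sym: "\<And>N x p. N \<ge> 1 \<Longrightarrow> x \<in> configs N \<Longrightarrow> p permutes {..<N} \<Longrightarrow> H N (x \<circ> p) = H N x"
    and equi: "equicontinuous_per_particle H"
    and conv: "\<And>u. u \<in> C0 \<Longrightarrow> convergent (min_energy H u)"
begin

lemma min_energy_tendsto: "u \<in> C0 \<Longrightarrow> min_energy H u \<longlonglongrightarrow> limit_energy H u"
  using conv[of u] by (simp add: limit_energy_def convergent_LIMSEQ_iff)

lemma diameter_bound: "\<exists>D>0. \<forall>p q :: 'a. dist p q \<le> D"
proof -
  obtain D where "\<forall>p\<in>UNIV. \<forall>q\<in>UNIV. dist (p::'a) q \<le> D"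
    using compact_imp_bounded[OF compact] unfolding bounded_two_points by blast
  then show ?thesis by (intro exI[of _ "max 1 D"]) (auto simp: le_max_iff_disj)
qed

lemma C0_bounded: "u \<in> C0 \<Longrightarrow> \<exists>B. \<forall>x. \<bar>u x\<bar> \<le> B" for u :: "'a \<Rightarrow> real"
proof -
  assume "u \<in> C0"
  then have "bounded (range u)"
    by (intro compact_imp_bounded compact_continuous_image compact) simp
  then show ?thesis by (auto simp: bounded_iff)
qed

lemma abs_emp_mean_le:
  assumes "N \<ge> 1" and "\<And>x. \<bar>u x\<bar> \<le> B"
  shows "\<bar>emp_mean N u x\<bar> \<le> B"
proof -
  have "\<bar>\<Sum>i<N. u (x i)\<bar> \<le> (\<Sum>i<N. B)" by (rule order_trans[OF sum_abs]) (intro sum_mono assms(2))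
  then show ?thesis unfolding emp_mean_def using assms(1) by (simp add: abs_mult field_simps)
qed

lemma emp_mean_linear:
  "emp_mean N (\<lambda>x. u x + t * v x) y = emp_mean N u y + t * emp_mean N v y"
  unfolding emp_mean_def by (simp add: sum.distrib sum_distrib_left algebra_simps)

lemma emp_mean_sum:
  "emp_mean N (\<lambda>x. \<Sum>j\<in>J. a j * \<phi> j x) y = (\<Sum>j\<in>J. a j * emp_mean N (\<phi> j) y)"
  unfolding emp_mean_def
  by (simp add: sum_distrib_left sum.swap[of _ _ J] algebra_simps)

lemma min_energy_eq: "min_energy H u N = (INF x\<in>configs N. H N x / real N + emp_mean N u x)"
  unfolding min_energy_def emp_mean_def by (simp add: algebra_simps add_divide_distrib)

lemma configs_nonempty: "configs N \<noteq> {}"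
  by (simp add: PiE_eq_empty_iff)

text \<open>One-sided form of the residue-class estimate, whose diameter bound comes from
  compactness. It serves to bound the infima below, to make the Hamiltonians bounded, and to control
  atypical configurations.\<close>

lemma oscillation_bound:
  obtains C where "C \<ge> 0" and "\<forall>\<^sub>F N in sequentially. \<forall>x\<in>configs N. \<forall>y\<in>configs N.
    H N x / real N \<le> H N y / real N + C"
proof -
  obtain D where "\<forall>p q :: 'a. dist p q \<le> D" using diameter_bound by blast
  from equicontinuous_per_particle_oscillation[OF equi this[rule_format]]
  obtain C where C: "C \<ge> 0" "\<forall>\<^sub>F N in sequentially. \<forall>x\<in>configs N. \<forall>y\<in>configs N. \<bar>H N x - H N y\<bar> / real N \<le> C"
    by blast
  have le: "H N x / real N \<le> H N y / real N + C" if "\<bar>H N x - H N y\<bar> / real N \<le> C" for N x y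
  proof -
    have "(H N x - H N y) / real N \<le> \<bar>H N x - H N y\<bar> / real N" by (intro divide_right_mono) auto
    then show ?thesis using that by (simp add: diff_divide_distrib)
  qed
  show ?thesis
  proof (rule that[OF C(1)])
    show "\<forall>\<^sub>F N in sequentially. \<forall>x\<in>configs N. \<forall>y\<in>configs N. H N x / real N \<le> H N y / real N + C"
      by (rule eventually_mono[OF C(2)]) (intro ballI le, blast)
  qed
qed

text \<open>A real infimum is a lower bound only for a set that is bounded below. The oscillation
  bound provides this, from an \<open>N\<close> on that depends on neither \<open>u\<close> nor
  \<open>x\<close>.\<close>

lemma min_energy_le:
  "\<forall>\<^sub>F N in sequentially. \<forall>u\<in>C0. \<forall>x\<in>configs N. min_energy H u N \<le> H N x / real N + emp_mean N u x"
proof -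
  obtain C where "C \<ge> 0" and ev: "\<forall>\<^sub>F N in sequentially. \<forall>x\<in>configs N. \<forall>y\<in>configs N.
    H N x / real N \<le> H N y / real N + C"
    using oscillation_bound by blast
  show ?thesis
    using ev eventually_ge_at_top[of 1]
  proof eventually_elim
    case (elim N)
    show ?case
    proof (intro ballI)
      fix u :: "'a \<Rightarrow> real" and x :: "nat \<Rightarrow> 'a"
      assume u: "u \<in> C0" and x: "x \<in> configs N"
      obtain B where B: "\<And>x. \<bar>u x\<bar> \<le> B" using C0_bounded[OF u] by blast
      have "H N x / real N - C - B \<le> H N y / real N + emp_mean N u y" if "y \<in> configs N" for y
      proof -
        have "H N x / real N \<le> H N y / real N + C" using elim(1) x that by blast
        then show ?thesis using abs_emp_mean_le[of N u B y, OF elim(2) B] by linarith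
      qed
      then have "bdd_below ((\<lambda>y. H N y / real N + emp_mean N u y) ` configs N)" by (rule bdd_belowI2)
      then show "min_energy H u N \<le> H N x / real N + emp_mean N u x"
        unfolding min_energy_eq using x by (rule cINF_lower)
    qed
  qed
qed

text \<open>The slack \<open>1 / N\<close> vanishes in the limit, so these configurations stand in
  for exact minimizers.\<close>

lemma near_minimizer_exists:
  assumes "N \<ge> 1"
  shows "\<exists>x\<in>configs N. H N x / real N + emp_mean N u x \<le> min_energy H u N + 1 / real N"
proof -
  have "(INF x\<in>configs N. H N x / real N + emp_mean N u x) < min_energy H u N + 1 / real N"
    unfolding min_energy_eq[symmetric] using assms by simp
  from cInf_lessD[OF _ this] show ?thesis using configs_nonempty by (auto intro: less_imp_le)
qed

text \<open>A near-minimizer for \<open>v\<close> is a test configuration for \<open>u\<close>, and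
  its empirical means of \<open>u\<close> and \<open>v\<close> compare in the same way as the
  functions.\<close>

lemma limit_energy_le:
  assumes u: "u \<in> C0" and v: "v \<in> C0" and le: "\<And>x. u x \<le> v x + c"
  shows "limit_energy H u \<le> limit_energy H v + c"
proof (rule tendsto_le[OF sequentially_bot])
  show "min_energy H u \<longlonglongrightarrow> limit_energy H u" by (rule min_energy_tendsto[OF u])
  have "(\<lambda>N. min_energy H v N + 1 / real N + c) \<longlonglongrightarrow> limit_energy H v + 0 + c"
    by (intro tendsto_intros min_energy_tendsto v lim_1_over_n)
  then show "(\<lambda>N. min_energy H v N + 1 / real N + c) \<longlonglongrightarrow> limit_energy H v + c" by simp
  show "\<forall>\<^sub>F N in sequentially. min_energy H u N \<le> min_energy H v N + 1 / real N + c"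
    using min_energy_le eventually_ge_at_top[of 1]
  proof eventually_elim
    case (elim N)
    obtain x where x: "x \<in> configs N" "H N x / real N + emp_mean N v x \<le> min_energy H v N + 1 / real N"
      using near_minimizer_exists[OF elim(2)] by blast
    have "(\<Sum>i<N. u (x i)) \<le> (\<Sum>i<N. v (x i) + c)" by (intro sum_mono le)
    then have "emp_mean N u x \<le> emp_mean N v x + c"
      unfolding emp_mean_def using elim(2) by (simp add: sum.distrib field_simps)
    moreover have "min_energy H u N \<le> H N x / real N + emp_mean N u x" using elim(1) u x(1) by blast
    ultimately show ?case using x(2) by linarith
  qed
qed

lemma limit_energy_lipschitz:
  assumes "u \<in> C0" "v \<in> C0" and "\<And>x. \<bar>u x - v x\<bar> \<le> c"
  shows "\<bar>limit_energy H u - limit_energy H v\<bar> \<le> c"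
proof -
  have le: "u x \<le> v x + c" "v x \<le> u x + c" for x using assms(3)[of x] by linarith+
  show ?thesis
    using limit_energy_le[OF assms(1,2) le(1)] limit_energy_le[OF assms(2,1) le(2)] by linarith
qed

text \<open>Perturbing the potential by t v moves the minimum by at most t times the empirical mean
  of v at a near-minimizer; hence difference quotients of the limit, taken with both signs of t,
  enclose these means.\<close>

lemma near_minimizer_emp_mean_tendsto:
  assumes u: "u \<in> C0" and v: "v \<in> C0"
    and deriv: "((\<lambda>t. limit_energy H (\<lambda>x. u x + t * v x)) has_real_derivative p) (at 0)"
    and X: "\<And>N. N \<ge> 1 \<Longrightarrow> X N \<in> configs N \<and> H N (X N) / real N + emp_mean N u (X N) \<le> min_energy H u N + 1 / real N"
  shows "(\<lambda>N. emp_mean N v (X N)) \<longlonglongrightarrow> p"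
proof -
  define g where "g t = limit_energy H (\<lambda>x. u x + t * v x)" for t
  have uv: "(\<lambda>x. u x + t * v x) \<in> C0" for t using u v by (auto intro!: continuous_intros)
  have quot: "((\<lambda>h. (g h - g 0) / h) \<longlongrightarrow> p) (at 0)"
    using deriv unfolding DERIV_def g_def[symmetric] by simp
  have g0: "g 0 = limit_energy H u" by (simp add: g_def)
  have lim: "(\<lambda>N. (min_energy H (\<lambda>x. u x + t * v x) N - min_energy H u N - 1 / real N) / t) \<longlonglongrightarrow> (g t - g 0) / t"
    if "t \<noteq> 0" for t
  proof -
    have "(\<lambda>N. (min_energy H (\<lambda>x. u x + t * v x) N - min_energy H u N - 1 / real N) / t)
        \<longlonglongrightarrow> (limit_energy H (\<lambda>x. u x + t * v x) - limit_energy H u - 0) / t"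
      by (intro tendsto_intros min_energy_tendsto uv u lim_1_over_n that)
    then show ?thesis by (simp add: g_def)
  qed
  \<comment> \<open>The near-minimizer for \<open>u\<close> competes in the infimum for the
    perturbed potential, where its energy changes by exactly
    \<open>t * emp_mean N v (X N)\<close>.\<close>
  have pert: "\<forall>\<^sub>F N in sequentially. min_energy H (\<lambda>x. u x + t * v x) N - min_energy H u N - 1 / real N
      \<le> t * emp_mean N v (X N)" for t
    using min_energy_le eventually_ge_at_top[of 1]
  proof eventually_elim
    case (elim N)
    have "min_energy H (\<lambda>x. u x + t * v x) N \<le> H N (X N) / real N + emp_mean N (\<lambda>x. u x + t * v x) (X N)"
      using elim(1) uv X[OF elim(2)] by blast
    then show ?case using X[OF elim(2)] unfolding emp_mean_linear by linarith
  qed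
  show ?thesis
  proof (rule order_tendstoI)
    fix a assume "a < p"
    from order_tendstoD(1)[OF quot this]
    obtain d where d: "d > 0" "\<And>h. h \<noteq> 0 \<Longrightarrow> dist h 0 < d \<Longrightarrow> a < (g h - g 0) / h"
      unfolding eventually_at by blast
    have t: "d / 2 > 0" "a < (g (d / 2) - g 0) / (d / 2)" by (use d(1) in simp, intro d(2)) (use d(1) in auto)
    have "\<forall>\<^sub>F N in sequentially. a < (min_energy H (\<lambda>x. u x + (d / 2) * v x) N - min_energy H u N - 1 / real N) / (d / 2)"
      by (rule order_tendstoD(1)[OF lim t(2)]) (use t in simp)
    then show "\<forall>\<^sub>F N in sequentially. a < emp_mean N v (X N)"
      using pert[of "d / 2"]
    proof eventually_elim
      case (elim N)
      from elim(2) have "(min_energy H (\<lambda>x. u x + (d / 2) * v x) N - min_energy H u N - 1 / real N) / (d / 2)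
          \<le> emp_mean N v (X N)" using t(1) by (subst pos_divide_le_eq) (simp_all add: mult.commute)
      then show ?case using elim(1) by linarith
    qed
  next
    fix a assume "p < a"
    from order_tendstoD(2)[OF quot this]
    obtain d where d: "d > 0" "\<And>h. h \<noteq> 0 \<Longrightarrow> dist h 0 < d \<Longrightarrow> (g h - g 0) / h < a"
      unfolding eventually_at by blast
    \<comment> \<open>Dividing \<open>pert\<close> by a negative \<open>t\<close> reverses the
      inequality and so bounds the empirical means from above.\<close>
    define t where "t = - (d / 2)"
    have t: "t < 0" "(g t - g 0) / t < a" unfolding t_def by (use d(1) in simp, intro d(2)) (use d(1) in auto)
    have "\<forall>\<^sub>F N in sequentially. (min_energy H (\<lambda>x. u x + t * v x) N - min_energy H u N - 1 / real N) / t < a"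
      by (rule order_tendstoD(2)[OF lim t(2)]) (use t in simp)
    then show "\<forall>\<^sub>F N in sequentially. emp_mean N v (X N) < a"
      using pert[of t]
    proof eventually_elim
      case (elim N)
      from elim(2) have "emp_mean N v (X N)
          \<le> (min_energy H (\<lambda>x. u x + t * v x) N - min_energy H u N - 1 / real N) / t"
        using t(1) by (subst neg_le_divide_eq) (simp_all add: mult.commute)
      then show ?case using elim(1) by linarith
    qed
  qed
qed

text \<open>The moments of a measure need not lie in the range of the gradient of the
  finite-dimensional free energy. A small quadratic penalty makes the supremum in the Legendre
  transform attained, at the cost of displacing the moments by at most \<open>\<eta> / 2\<close>; this replaces the
  Brondsted-Rockafellar theorem.\<close>

lemma recovery_configurations:
  fixes \<mu> :: "'a measure" and \<phi> :: "'i \<Rightarrow> 'a \<Rightarrow> real"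
  assumes "prob_space \<mu>" and sets: "sets \<mu> = sets borel"
    and gateaux: "gateaux_differentiable_C0 (limit_energy H)"
    and J: "finite J" and \<phi>: "\<And>j. \<phi> j \<in> C0" "\<And>j x. 0 \<le> \<phi> j x" "\<And>j x. \<phi> j x \<le> 1"
    and e: "\<And>u. u \<in> C0 \<Longrightarrow> limit_energy H u - (\<integral>x. u x \<partial>\<mu>) \<le> e"
    and \<eta>: "\<eta> > 0"
  shows "\<forall>\<^sub>F N in sequentially. \<exists>x\<in>configs N.
    (\<forall>j\<in>J. \<bar>emp_mean N (\<phi> j) x - (\<integral>x. \<phi> j x \<partial>\<mu>)\<bar> \<le> \<eta>) \<and> H N x / real N \<le> e + \<eta>"
proof -
  interpret prob_space \<mu> by fact
  define m where "m j = (\<integral>x. \<phi> j x \<partial>\<mu>)" for j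
  define U where "U a x = (\<Sum>j\<in>J. a j * \<phi> j x)" for a x
  define G where "G a = limit_energy H (U a)" for a
  have UC0: "U a \<in> C0" for a
    using \<phi>(1) unfolding U_def by (auto intro!: continuous_intros)
  have int: "integrable \<mu> (\<phi> j)" for j
  proof (rule integrable_const_bound[where B = 1])
    show "\<phi> j \<in> borel_measurable \<mu>"
      using borel_measurable_continuous_onI[of "\<phi> j"] \<phi>(1)[of j] measurable_cong_sets[OF sets refl] by auto
  qed (use \<phi> in auto)
  have intU: "(\<integral>x. U a x \<partial>\<mu>) = (\<Sum>j\<in>J. a j * m j)" for a
    unfolding U_def m_def using int by simp
  have bound: "G a - (\<Sum>j\<in>J. a j * m j) \<le> e" for a
    using e[OF UC0] unfolding G_def intU .
  have lip: "\<bar>G a - G b\<bar> \<le> (\<Sum>j\<in>J. \<bar>a j - b j\<bar>)" for a b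
    unfolding G_def
  proof (rule limit_energy_lipschitz[OF UC0 UC0])
    fix x
    have "\<bar>U a x - U b x\<bar> = \<bar>\<Sum>j\<in>J. (a j - b j) * \<phi> j x\<bar>"
      unfolding U_def by (simp add: sum_subtractf left_diff_distrib)
    also have "\<dots> \<le> (\<Sum>j\<in>J. \<bar>a j - b j\<bar> * \<bar>\<phi> j x\<bar>)"
      using sum_abs[of "\<lambda>j. (a j - b j) * \<phi> j x" J] by (simp add: abs_mult)
    also have "\<dots> \<le> (\<Sum>j\<in>J. \<bar>a j - b j\<bar> * 1)"
      by (intro sum_mono mult_left_mono) (use \<phi> in auto)
    finally show "\<bar>U a x - U b x\<bar> \<le> (\<Sum>j\<in>J. \<bar>a j - b j\<bar>)" by simp
  qed
  \<comment> \<open>Comparing the maximizer with the zero vector bounds its penalty by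
    \<open>e - G (\<lambda>_. 0)\<close>; the added 1 keeps \<open>B\<close> positive for the
    division below. The choice of \<open>\<tau>\<close> makes
    \<open>2 * \<tau> * B = (\<eta> / 2)\<^sup>2\<close>, whence
    \<open>\<bar>\<tau> * a j\<bar> \<le> \<eta> / 2\<close>.\<close>
  define B where "B = e - G (\<lambda>_. 0) + 1"
  have B: "B > 0" using bound[of "\<lambda>_. 0"] unfolding B_def by simp
  define \<tau> where "\<tau> = \<eta>\<^sup>2 / (8 * B)"
  have \<tau>: "\<tau> > 0" using B \<eta> by (simp add: \<tau>_def)
  define \<Phi> where "\<Phi> a = G a - (\<Sum>j\<in>J. a j * m j) - \<tau> / 2 * (\<Sum>j\<in>J. (a j)\<^sup>2)" for a
  obtain a where a: "\<And>b. \<Phi> b \<le> \<Phi> a"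
    using penalized_maximum_exists[of J G m e \<tau>, OF J lip bound \<tau>] unfolding \<Phi>_def by blast
  have small: "\<bar>\<tau> * a j\<bar> \<le> \<eta> / 2" if "j \<in> J" for j
  proof -
    have "G (\<lambda>_. 0) \<le> \<Phi> a" using a[of "\<lambda>_. 0"] by (simp add: \<Phi>_def)
    then have "\<tau> / 2 * (\<Sum>j\<in>J. (a j)\<^sup>2) \<le> B" using bound[of a] unfolding \<Phi>_def B_def by linarith
    moreover have "(a j)\<^sup>2 \<le> (\<Sum>j\<in>J. (a j)\<^sup>2)" using J that by (intro member_le_sum) auto
    then have "\<tau> / 2 * (a j)\<^sup>2 \<le> \<tau> / 2 * (\<Sum>j\<in>J. (a j)\<^sup>2)" using \<tau> by (intro mult_left_mono) auto
    ultimately have "\<tau> / 2 * (a j)\<^sup>2 \<le> B" by linarith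
    then have "(2 * \<tau>) * (\<tau> / 2 * (a j)\<^sup>2) \<le> (2 * \<tau>) * B" using \<tau> by (intro mult_left_mono) auto
    also have "(2 * \<tau>) * B = (\<eta> / 2)\<^sup>2" unfolding \<tau>_def using B by (simp add: field_simps power2_eq_square)
    also have "(2 * \<tau>) * (\<tau> / 2 * (a j)\<^sup>2) = \<bar>\<tau> * a j\<bar>\<^sup>2"
      by (simp add: power_mult_distrib power2_eq_square[of \<tau>])
    finally have "\<bar>\<tau> * a j\<bar>\<^sup>2 \<le> (\<eta> / 2)\<^sup>2" .
    then show ?thesis by (rule power2_le_imp_le) (use \<eta> in simp)
  qed
  have deriv: "((\<lambda>t. limit_energy H (\<lambda>x. U a x + t * \<phi> j x)) has_real_derivative (m j + \<tau> * a j)) (at 0)"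
    if j: "j \<in> J" for j
  proof -
    define g where "g t = limit_energy H (\<lambda>x. U a x + t * \<phi> j x)" for t
    have "g differentiable_on UNIV"
      using gateaux UC0[of a] \<phi>(1)[of j] unfolding gateaux_differentiable_C0_def g_def by blast
    then have "g differentiable (at 0)" by (simp add: differentiable_on_def)
    then obtain p where p: "(g has_real_derivative p) (at 0)"
      using real_differentiable_def by blast
    have split: "(\<Sum>i\<in>J. f ((a(j := a j + t)) i) i) = (\<Sum>i\<in>J. f (a i) i) + (f (a j + t) j - f (a j) j)"
      for f :: "real \<Rightarrow> 'i \<Rightarrow> real" and t
      using J j by (subst (1 2) sum.remove[of _ j]) auto
    have Ut: "U (a(j := a j + t)) = (\<lambda>x. U a x + t * \<phi> j x)" for t
      unfolding U_def by (rule ext) (subst split[of "\<lambda>r i. r * \<phi> i _"], simp add: algebra_simps)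
    have \<Phi>t: "\<Phi> (a(j := a j + t)) = g t - ((\<Sum>i\<in>J. a i * m i) + t * m j)
        - \<tau> / 2 * ((\<Sum>i\<in>J. (a i)\<^sup>2) + ((a j + t)\<^sup>2 - (a j)\<^sup>2))" for t
      unfolding \<Phi>_def G_def Ut g_def split[of "\<lambda>r i. r * m i"] split[of "\<lambda>r i. r\<^sup>2"]
      by (simp add: algebra_simps)
    \<comment> \<open>Stationarity of \<open>\<Phi>\<close> at its maximum in the direction of
      coordinate \<open>j\<close> identifies the derivative of the limit functional as the moment of
      \<open>\<mu>\<close> plus the displacement \<open>\<tau> * a j\<close>.\<close>
    have "((\<lambda>t. \<Phi> (a(j := a j + t))) has_real_derivative (p - m j - \<tau> * a j)) (at 0)"
      unfolding \<Phi>t by (auto intro!: derivative_eq_intros p)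
    then have "p - m j - \<tau> * a j = 0"
      by (rule DERIV_local_max[of _ _ _ 1]) (use a in auto)
    then show ?thesis using p unfolding g_def by (simp add: algebra_simps)
  qed
  obtain X where X: "\<And>N. N \<ge> 1 \<Longrightarrow> X N \<in> configs N \<and>
      H N (X N) / real N + emp_mean N (U a) (X N) \<le> min_energy H (U a) N + 1 / real N"
    using near_minimizer_exists[of _ "U a"] by metis
  have moments: "(\<lambda>N. emp_mean N (\<phi> j) (X N)) \<longlonglongrightarrow> m j + \<tau> * a j" if "j \<in> J" for j
    by (rule near_minimizer_emp_mean_tendsto[OF UC0 \<phi>(1) deriv[OF that] X])
  \<comment> \<open>This sequence bounds the energy per particle of \<open>X N\<close>. Its limit is
    the unpenalized Legendre value at \<open>a\<close>, at most \<open>e\<close>, minus the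
    nonnegative term \<open>\<tau> * (\<Sum>j\<in>J. (a j)\<^sup>2)\<close>, so the displacement of
    the moments only lowers the energy bound.\<close>
  have "(\<lambda>N. min_energy H (U a) N + 1 / real N - (\<Sum>j\<in>J. a j * emp_mean N (\<phi> j) (X N)))
      \<longlonglongrightarrow> G a + 0 - (\<Sum>j\<in>J. a j * (m j + \<tau> * a j))"
    unfolding G_def by (intro tendsto_intros min_energy_tendsto UC0 lim_1_over_n moments)
  moreover have "G a + 0 - (\<Sum>j\<in>J. a j * (m j + \<tau> * a j)) < e + \<eta>"
  proof -
    have "0 \<le> (\<Sum>j\<in>J. a j * (\<tau> * a j))"
      using \<tau> by (intro sum_nonneg) (simp add: mult.left_commute)
    then show ?thesis using bound[of a] \<eta> by (simp add: distrib_left sum.distrib)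
  qed
  ultimately have energy: "\<forall>\<^sub>F N in sequentially.
      min_energy H (U a) N + 1 / real N - (\<Sum>j\<in>J. a j * emp_mean N (\<phi> j) (X N)) < e + \<eta>"
    by (rule order_tendstoD(2))
  have close: "\<forall>\<^sub>F N in sequentially. \<forall>j\<in>J. \<bar>emp_mean N (\<phi> j) (X N) - m j\<bar> \<le> \<eta>"
  proof (intro eventually_ball_finite[OF J] ballI)
    fix j assume j: "j \<in> J"
    \<comment> \<open>Half of the tolerance \<open>\<eta>\<close> is spent on the displacement
      \<open>\<tau> * a j\<close>, the other half on convergence.\<close>
    have "\<forall>\<^sub>F N in sequentially. dist (emp_mean N (\<phi> j) (X N)) (m j + \<tau> * a j) < \<eta> / 2"
      using \<eta> by (intro tendstoD[OF moments[OF j]]) auto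
    then show "\<forall>\<^sub>F N in sequentially. \<bar>emp_mean N (\<phi> j) (X N) - m j\<bar> \<le> \<eta>"
      by eventually_elim (use small[OF j] in \<open>unfold dist_real_def, linarith\<close>)
  qed
  show ?thesis
    using energy close eventually_ge_at_top[of 1]
  proof eventually_elim
    case (elim N)
    have "H N (X N) / real N \<le> e + \<eta>"
      using X[OF elim(3)] elim(1) unfolding U_def emp_mean_sum by linarith
    then show ?case using elim(2) X[OF elim(3)] unfolding m_def by blast
  qed
qed

end

section \<open>Mean energy of product measures\<close>

definition mean_energy :: "(nat \<Rightarrow> (nat \<Rightarrow> 'a) \<Rightarrow> real) \<Rightarrow> 'a measure \<Rightarrow> nat \<Rightarrow> real" where
  "mean_energy H \<mu> N = (1 / real N) * (\<integral>x. H N x \<partial>(PiM {..<N} (\<lambda>_. \<mu>)))"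

section \<open>Integrability and the lower bound for the mean energy\<close>

context convergent_particle_system
begin

text \<open>For fixed \<open>K\<close>, equicontinuity with tolerance \<open>\<epsilon> / K\<close>
  amounts to uniform continuity of \<open>H K\<close> itself.\<close>

lemma hamiltonian_measurable:
  assumes "K \<ge> 1" and "sets \<mu> = sets borel"
  shows "H K \<in> borel_measurable (PiM {..<K} (\<lambda>_. \<mu>))"
proof (rule borel_measurable_of_config_continuity[OF compact assms(2)])
  fix \<epsilon> :: real assume "\<epsilon> > 0"
  then have "\<epsilon> / real K > 0" using assms(1) by simp
  from equi[unfolded equicontinuous_per_particle_def, THEN spec, THEN mp, OF this]
  obtain \<delta> where \<delta>: "\<delta> > 0 \<and> (\<forall>N\<ge>1. \<forall>x\<in>configs N. \<forall>y\<in>configs N.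
      config_dist N x y \<le> \<delta> \<longrightarrow> \<bar>H N x - H N y\<bar> / real N \<le> \<epsilon> / real K)"
    ..
  have "\<bar>H K x - H K y\<bar> \<le> \<epsilon>" if "\<bar>H K x - H K y\<bar> / real K \<le> \<epsilon> / real K" for x y
    using that assms(1) by (simp add: divide_le_cancel)
  then show "\<exists>\<delta>>0. \<forall>x\<in>configs K. \<forall>y\<in>configs K. config_dist K x y \<le> \<delta> \<longrightarrow> \<bar>H K x - H K y\<bar> \<le> \<epsilon>"
    using conjunct1[OF \<delta>] conjunct2[OF \<delta>, rule_format, OF assms(1)] by (intro exI[of _ \<delta>]) simp
qed

lemma hamiltonian_integrable:
  fixes \<mu> :: "'a measure"
  assumes "prob_space \<mu>" and sets: "sets \<mu> = sets borel"
  shows "\<forall>\<^sub>F N in sequentially. integrable (PiM {..<N} (\<lambda>_. \<mu>)) (H N)"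
proof -
  obtain C where "C \<ge> 0" and osc: "\<forall>\<^sub>F N in sequentially. \<forall>x\<in>configs N. \<forall>y\<in>configs N.
    H N x / real N \<le> H N y / real N + C"
    using oscillation_bound by blast
  show ?thesis
    using osc eventually_ge_at_top[of 1]
  proof eventually_elim
    case (elim N)
    interpret P: prob_space "PiM {..<N} (\<lambda>_. \<mu>)" by (rule prob_space_PiM) (rule assms(1))
    obtain y :: "nat \<Rightarrow> 'a" where y: "y \<in> configs N" using configs_nonempty by (metis ex_in_conv)
    have "\<bar>H N x\<bar> \<le> \<bar>H N y\<bar> + real N * C" if "x \<in> configs N" for x
    proof -
      have "H N x \<le> H N y + real N * C" "H N y \<le> H N x + real N * C"
      proof -
        have "H N x / real N \<le> H N y / real N + C" "H N y / real N \<le> H N x / real N + C"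
          using elim(1) that y by blast+
        then show "H N x \<le> H N y + real N * C" "H N y \<le> H N x + real N * C"
          using elim(2) by (simp_all add: field_simps)
      qed
      then show ?thesis by linarith
    qed
    then show ?case
      using hamiltonian_measurable[OF elim(2) sets] sets_eq_imp_space_eq[OF sets]
      by (intro P.integrable_const_bound[where B = "\<bar>H N y\<bar> + real N * C"] AE_I2)
         (auto simp: space_PiM)
  qed
qed

lemma C0_integrable:
  fixes \<mu> :: "'a measure"
  assumes "prob_space \<mu>" and sets: "sets \<mu> = sets borel" and u: "u \<in> C0"
  shows "integrable \<mu> u"
proof -
  interpret prob_space \<mu> by fact
  obtain B where B: "\<And>x. \<bar>u x\<bar> \<le> B" using C0_bounded[OF u] by blast
  have "u \<in> borel_measurable \<mu>"
    using borel_measurable_continuous_onI[of u] u measurable_cong_sets[OF sets refl] by auto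
  then show ?thesis using B by (intro integrable_const_bound[where B = B]) auto
qed

text \<open>The infimum is at most an average over the product measure, under which the empirical
  mean of \<open>u\<close> integrates to the integral of \<open>u\<close> against
  \<open>\<mu>\<close>.\<close>

lemma min_energy_le_mean_energy:
  fixes \<mu> :: "'a measure"
  assumes "prob_space \<mu>" and sets: "sets \<mu> = sets borel"
  shows "\<forall>\<^sub>F N in sequentially. \<forall>u\<in>C0. min_energy H u N \<le> mean_energy H \<mu> N + (\<integral>x. u x \<partial>\<mu>)"
  using min_energy_le hamiltonian_integrable[OF assms] eventually_ge_at_top[of 1]
proof eventually_elim
  case (elim N)
  interpret P: prob_space "PiM {..<N} (\<lambda>_. \<mu>)" by (rule prob_space_PiM) (rule assms(1))
  show ?case
  proof
    fix u :: "'a \<Rightarrow> real" assume u: "u \<in> C0"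
    note emp = integral_emp_mean[OF assms(1) elim(3) C0_integrable[OF assms u]]
    have "min_energy H u N \<le> (\<integral>x. H N x / real N + emp_mean N u x \<partial>PiM {..<N} (\<lambda>_. \<mu>))"
      using elim(1,2) u emp(1) sets_eq_imp_space_eq[OF sets]
      by (intro P.integral_ge_const AE_I2 Bochner_Integration.integrable_add integrable_divide)
         (auto simp: space_PiM)
    also have "\<dots> = mean_energy H \<mu> N + (\<integral>x. u x \<partial>\<mu>)"
      using elim(2) emp unfolding mean_energy_def by simp
    finally show "min_energy H u N \<le> mean_energy H \<mu> N + (\<integral>x. u x \<partial>\<mu>)" .
  qed
qed

text \<open>Passing to the limit in the previous inequality turns an eventual bound on the mean
  energy into a bound on the supremum defining \<open>macro_energy\<close>.\<close>

lemma limit_energy_le_of_mean_energy_le: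
  fixes \<mu> :: "'a measure"
  assumes "prob_space \<mu>" and "sets \<mu> = sets borel" and u: "u \<in> C0"
    and le: "\<forall>\<^sub>F N in sequentially. mean_energy H \<mu> N \<le> c"
  shows "limit_energy H u - (\<integral>x. u x \<partial>\<mu>) \<le> c"
proof -
  have "\<forall>\<^sub>F N in sequentially. min_energy H u N \<le> c + (\<integral>x. u x \<partial>\<mu>)"
    using min_energy_le_mean_energy[OF assms(1,2)] le
    by eventually_elim (use u in force)
  from tendsto_upperbound[OF min_energy_tendsto[OF u] this] show ?thesis by simp
qed

text \<open>The oscillation bound compares every configuration with a near-minimizer for the zero
  potential, whose energy per particle is controlled by the limit functional.\<close>

lemma mean_energy_bounded:
  fixes \<mu> :: "'a measure"
  assumes "prob_space \<mu>" and sets: "sets \<mu> = sets borel"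
  shows "\<exists>c. \<forall>\<^sub>F N in sequentially. mean_energy H \<mu> N \<le> c"
proof -
  obtain C where "C \<ge> 0" and osc: "\<forall>\<^sub>F N in sequentially. \<forall>x\<in>configs N. \<forall>y\<in>configs N.
    H N x / real N \<le> H N y / real N + C"
    using oscillation_bound by blast
  let ?L = "limit_energy H (\<lambda>_. 0)"
  have zero: "(\<lambda>_. 0) \<in> C0" by simp
  have "\<forall>\<^sub>F N in sequentially. min_energy H (\<lambda>_. 0) N < ?L + 1"
    by (rule order_tendstoD(2)[OF min_energy_tendsto[OF zero]]) simp
  then have "\<forall>\<^sub>F N in sequentially. mean_energy H \<mu> N \<le> ?L + 2 + C"
    using osc hamiltonian_integrable[OF assms] eventually_ge_at_top[of 1]
  proof eventually_elim
    case (elim N)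
    interpret P: prob_space "PiM {..<N} (\<lambda>_. \<mu>)" by (rule prob_space_PiM) (rule assms(1))
    obtain y where y: "y \<in> configs N" "H N y / real N + emp_mean N (\<lambda>_. 0) y \<le> min_energy H (\<lambda>_. 0) N + 1 / real N"
      using near_minimizer_exists[OF elim(4), of "\<lambda>_. 0"] by blast
    have "1 / real N \<le> 1" using elim(4) by simp
    then have Hy: "H N y / real N \<le> ?L + 2" using y(2) elim(1) by (simp add: emp_mean_def)
    have "(\<integral>x. H N x / real N \<partial>PiM {..<N} (\<lambda>_. \<mu>)) \<le> ?L + 2 + C"
    proof (intro P.integral_le_const AE_I2 integrable_divide elim(3))
      fix x assume "x \<in> space (PiM {..<N} (\<lambda>_. \<mu>))"
      then have "x \<in> configs N" using sets_eq_imp_space_eq[OF sets] by (simp add: space_PiM)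
      then show "H N x / real N \<le> ?L + 2 + C" using elim(2) y(1) Hy by force
    qed
    then show ?case unfolding mean_energy_def by simp
  qed
  then show ?thesis by blast
qed

section \<open>The upper bound for the mean energy\<close>

text \<open>A bump is at most the indicator of its positivity set, so its empirical mean bounds from
  below the fraction of particles in that cell.\<close>

lemma card_support_ge:
  fixes f :: "'a \<Rightarrow> real"
  assumes "N \<ge> 1" and "\<And>x. 0 \<le> f x" and "\<And>x. f x \<le> 1"
  shows "real N * emp_mean N f x \<le> real (card {i. i < N \<and> x i \<in> {p. f p > 0}})"
proof -
  have "real N * emp_mean N f x = (\<Sum>i<N. f (x i))" unfolding emp_mean_def using assms(1) by simp
  also have "\<dots> \<le> (\<Sum>i<N. if f (x i) > 0 then 1 else 0)"
    by (intro sum_mono) (use assms(2,3) in \<open>auto simp: not_less intro: antisym\<close>)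
  also have "\<dots> = real (card {i. i < N \<and> x i \<in> {p. f p > 0}})"
  proof -
    have "{..<N} \<inter> {i. f (x i) > 0} = {i. i < N \<and> x i \<in> {p. f p > 0}}" by auto
    then show ?thesis by (simp add: sum.If_cases)
  qed
  finally show ?thesis .
qed

text \<open>Both configurations have at least \<open>N * (m j - \<eta>)\<close> particles in cell
  \<open>j\<close>, so the matching permutation brings \<open>y\<close> within
  \<open>config_dist\<close> \<open>\<delta>\<close> of \<open>x\<close>. The \<open>budget\<close>
  adds the cell diameter and the cost \<open>D\<close> of the unmatched fraction; symmetry of
  \<open>H N\<close> makes the permutation free of charge.\<close>

lemma energy_le_of_close_moments:
  fixes \<phi> :: "nat \<Rightarrow> 'a \<Rightarrow> real"
  assumes \<delta>: "\<And>N x y. N \<ge> 1 \<Longrightarrow> x \<in> configs N \<Longrightarrow> y \<in> configs N \<Longrightarrow>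
      config_dist N x y \<le> \<delta> \<Longrightarrow> \<bar>H N x - H N y\<bar> / real N \<le> \<kappa>"
    and D: "D > 0" "\<And>p q :: 'a. dist p q \<le> D"
    and \<phi>: "\<And>j x. 0 \<le> \<phi> j x" "\<And>j x. \<phi> j x \<le> 1" "disjoint_family_on (\<lambda>j. {x. \<phi> j x > 0}) {..<k}"
    and diam: "\<And>j x y. \<phi> j x > 0 \<Longrightarrow> \<phi> j y > 0 \<Longrightarrow> dist x y \<le> r" and r: "0 \<le> r"
    and budget: "r + D * (1 - (\<Sum>j<k. m j - \<eta>)) \<le> \<delta>"
    and N: "N \<ge> 1" and x: "x \<in> configs N" and y: "y \<in> configs N"
    and mx: "\<And>j. j < k \<Longrightarrow> m j - \<eta> \<le> emp_mean N (\<phi> j) x"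
    and my: "\<And>j. j < k \<Longrightarrow> m j - \<eta> \<le> emp_mean N (\<phi> j) y"
  shows "H N y / real N \<le> H N x / real N + \<kappa>"
proof -
  \<comment> \<open>The ceiling still lies below any integer count that is at least
    \<open>N * (m j - \<eta>)\<close>, and \<open>nat\<close> turns a negative requirement into
    0.\<close>
  define n where "n j = nat \<lceil>real N * (m j - \<eta>)\<rceil>" for j
  have n_le: "n j \<le> card {i. i < N \<and> z i \<in> {p. \<phi> j p > 0}}" if "m j - \<eta> \<le> emp_mean N (\<phi> j) z" for j z
  proof -
    have "real N * (m j - \<eta>) \<le> real N * emp_mean N (\<phi> j) z" using that by (intro mult_left_mono) auto
    also have "\<dots> \<le> real (card {i. i < N \<and> z i \<in> {p. \<phi> j p > 0}})"
      by (rule card_support_ge[OF N \<phi>(1,2)])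
    finally show ?thesis unfolding n_def by (simp add: nat_le_iff ceiling_le_iff)
  qed
  have n_ge: "real N * (m j - \<eta>) \<le> real (n j)" for j unfolding n_def by linarith
  obtain \<sigma> where \<sigma>: "\<sigma> permutes {..<N}"
    "(\<Sum>i<N. dist (x i) (y (\<sigma> i))) \<le> r * real N + D * (real N - (\<Sum>j<k. real (n j)))"
  proof (rule cell_matching_permutation[of "{..<k}" "\<lambda>j. {p. \<phi> j p > 0}" r D n N x y])
    show "dist p q \<le> r" if "p \<in> {p. \<phi> j p > 0}" "q \<in> {p. \<phi> j p > 0}" for j p q
      using diam that by blast
    show "n j \<le> card {i. i < N \<and> x i \<in> {p. \<phi> j p > 0}}" if "j \<in> {..<k}" for j
      using n_le[OF mx] that by blast
    show "n j \<le> card {i. i < N \<and> y i \<in> {p. \<phi> j p > 0}}" if "j \<in> {..<k}" for j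
      using n_le[OF my] that by blast
  qed (use \<phi>(3) D(2) r in auto)
  have y\<sigma>: "y \<circ> \<sigma> \<in> configs N"
    using y \<sigma>(1) by (auto simp: PiE_def extensional_def permutes_in_image permutes_not_in)
  have "real N * (\<Sum>j<k. m j - \<eta>) \<le> (\<Sum>j<k. real (n j))"
    unfolding sum_distrib_left by (intro sum_mono n_ge)
  then have "D * (real N - (\<Sum>j<k. real (n j))) \<le> D * (real N - real N * (\<Sum>j<k. m j - \<eta>))"
    using D(1) by (intro mult_left_mono) auto
  then have "(\<Sum>i<N. dist (x i) (y (\<sigma> i))) \<le> real N * (r + D * (1 - (\<Sum>j<k. m j - \<eta>)))"
    using \<sigma>(2) by (simp add: algebra_simps)
  also have "\<dots> \<le> real N * \<delta>" using budget by (intro mult_left_mono) auto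
  finally have "config_dist N x (y \<circ> \<sigma>) \<le> \<delta>"
    unfolding config_dist_def using N by (simp add: field_simps)
  from \<delta>[OF N x y\<sigma> this] have "\<bar>H N x - H N y\<bar> / real N \<le> \<kappa>" using sym[OF N y \<sigma>(1)] by simp
  moreover have "(H N y - H N x) / real N \<le> \<bar>H N x - H N y\<bar> / real N" by (intro divide_right_mono) auto
  ultimately show ?thesis by (simp add: diff_divide_distrib)
qed

text \<open>Away from the event that all empirical moments of y are close to those of \<open>\<mu>\<close>, the Chebyshev
  weight in the pointwise bound is at least 1 and absorbs the oscillation constant C.\<close>

lemma mean_energy_le:
  fixes \<mu> :: "'a measure"
  assumes "prob_space \<mu>" and sets: "sets \<mu> = sets borel"
    and gateaux: "gateaux_differentiable_C0 (limit_energy H)"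
    and e: "\<And>u. u \<in> C0 \<Longrightarrow> limit_energy H u - (\<integral>x. u x \<partial>\<mu>) \<le> e"
    and \<kappa>: "\<kappa> > 0"
  shows "\<forall>\<^sub>F N in sequentially. mean_energy H \<mu> N \<le> e + 3 * \<kappa>"
proof -
  from equi[unfolded equicontinuous_per_particle_def, THEN spec, THEN mp, OF \<kappa>]
  obtain \<delta> where \<delta>': "\<delta> > 0 \<and> (\<forall>N\<ge>1. \<forall>x\<in>configs N. \<forall>y\<in>configs N.
      config_dist N x y \<le> \<delta> \<longrightarrow> \<bar>H N x - H N y\<bar> / real N \<le> \<kappa>)"
    ..
  note \<delta> = conjunct1[OF \<delta>'] conjunct2[OF \<delta>', rule_format]
  obtain D where "D > 0" and D': "\<forall>p q :: 'a. dist p q \<le> D" using diameter_bound by blast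
  note D = \<open>D > 0\<close> D'[rule_format]
  obtain C where C: "C \<ge> 0" and osc: "\<forall>\<^sub>F N in sequentially. \<forall>x\<in>configs N. \<forall>y\<in>configs N.
    H N x / real N \<le> H N y / real N + C"
    using oscillation_bound by blast
  \<comment> \<open>The budget \<open>\<delta>\<close> is split into \<open>\<delta> / 2\<close> for
    the cell diameters, \<open>\<delta> / 4\<close> for the mass missed by the bumps and
    \<open>\<delta> / 4\<close> for the \<open>k\<close> moment errors.\<close>
  define \<epsilon> where "\<epsilon> = min (\<delta> / 2) (\<delta> / (4 * D))"
  have \<epsilon>: "\<epsilon> > 0" "\<epsilon> \<le> \<delta> / 2" "D * \<epsilon> \<le> \<delta> / 4"
  proof -
    show "\<epsilon> > 0" "\<epsilon> \<le> \<delta> / 2" using \<delta>(1) D(1) by (auto simp: \<epsilon>_def)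
    have "D * \<epsilon> \<le> D * (\<delta> / (4 * D))" using D(1) by (intro mult_left_mono) (auto simp: \<epsilon>_def)
    then show "D * \<epsilon> \<le> \<delta> / 4" using D(1) by simp
  qed
  obtain k and \<phi> :: "nat \<Rightarrow> 'a \<Rightarrow> real"
    where cont: "\<And>j. continuous_on UNIV (\<phi> j)" and \<phi>: "\<And>j x. 0 \<le> \<phi> j x" "\<And>j x. \<phi> j x \<le> 1"
      "disjoint_family_on (\<lambda>j. {x. \<phi> j x > 0}) {..<k}"
    and diam: "\<And>j x y. \<phi> j x > 0 \<Longrightarrow> \<phi> j y > 0 \<Longrightarrow> dist x y \<le> \<epsilon>"
    and mass: "(\<Sum>j<k. \<integral>x. \<phi> j x \<partial>\<mu>) \<ge> 1 - \<epsilon>"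
    by (rule small_bumps_exist[OF compact assms(1,2) \<epsilon>(1)]) blast
  define m where "m j = (\<integral>x. \<phi> j x \<partial>\<mu>)" for j
  \<comment> \<open>The first bound limits the energy error, the second the total moment error;
    \<open>k + 1\<close> keeps the denominator positive when there are no bumps.\<close>
  define \<eta> where "\<eta> = min \<kappa> (\<delta> / (4 * D * (real k + 1)))"
  have \<eta>: "\<eta> > 0" "\<eta> \<le> \<kappa>" using \<kappa> \<delta>(1) D(1) by (auto simp: \<eta>_def)
  have "D * (real k * \<eta>) \<le> \<delta> / 4"
  proof -
    have "D * (real k * \<eta>) \<le> D * ((real k + 1) * (\<delta> / (4 * D * (real k + 1))))"
      using D(1) \<eta>(1) by (intro mult_left_mono mult_mono) (auto simp: \<eta>_def)
    also have "\<dots> = \<delta> / 4"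
    proof -
      have cancel: "D * (c * (\<delta> / (4 * D * c))) = \<delta> / 4" if "c > 0" for c :: real
        using D(1) that by simp
      show ?thesis by (rule cancel) simp
    qed
    finally show ?thesis .
  qed
  moreover have "D * (1 - (\<Sum>j<k. m j)) \<le> D * \<epsilon>"
    using D(1) mass by (intro mult_left_mono) (auto simp: m_def)
  ultimately have budget: "\<epsilon> + D * (1 - (\<Sum>j<k. m j - \<eta>)) \<le> \<delta>"
    using \<epsilon>(2,3) by (simp add: sum_subtractf algebra_simps)
  have recovery: "\<forall>\<^sub>F N in sequentially. \<exists>x\<in>configs N.
      (\<forall>j\<in>{..<k}. \<bar>emp_mean N (\<phi> j) x - m j\<bar> \<le> \<eta>) \<and> H N x / real N \<le> e + \<eta>"
    unfolding m_def
    by (rule recovery_configurations[OF assms(1,2) gateaux _ _ \<phi>(1,2) e \<eta>(1)]) (use cont in auto)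
  have "(\<lambda>N. C * (real k / \<eta>\<^sup>2) * (1 / real N)) \<longlonglongrightarrow> C * (real k / \<eta>\<^sup>2) * 0"
    by (intro tendsto_mult tendsto_const lim_1_over_n)
  then have "\<forall>\<^sub>F N in sequentially. C * (real k / \<eta>\<^sup>2) * (1 / real N) < \<kappa>"
    by (rule order_tendstoD) (use \<kappa> in simp)
  then show ?thesis
    using recovery osc hamiltonian_integrable[OF assms(1,2)] eventually_ge_at_top[of 1]
  proof eventually_elim
    case (elim N)
    note N = elim(5)
    let ?P = "PiM {..<N} (\<lambda>_. \<mu>)"
    interpret P: prob_space ?P by (rule prob_space_PiM) (rule assms(1))
    obtain x where x: "x \<in> configs N" "\<And>j. j < k \<Longrightarrow> \<bar>emp_mean N (\<phi> j) x - m j\<bar> \<le> \<eta>"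
      "H N x / real N \<le> e + \<eta>"
      using elim(2) by blast
    \<comment> \<open>Chebyshev weight: its integral is at most \<open>k / N\<close> by the variance
      bound, and it is at least \<open>\<eta>\<^sup>2\<close> as soon as one moment misses its
      target by more than \<open>\<eta>\<close>.\<close>
    define w where "w y = (\<Sum>j<k. (emp_mean N (\<phi> j) y - m j)\<^sup>2)" for y
    have w0: "0 \<le> w y" for y unfolding w_def by (intro sum_nonneg) auto
    have pointwise: "H N y / real N \<le> e + 2 * \<kappa> + C / \<eta>\<^sup>2 * w y" if y: "y \<in> configs N" for y
    proof (cases "\<forall>j<k. \<bar>emp_mean N (\<phi> j) y - m j\<bar> \<le> \<eta>")
      case True
      have "H N y / real N \<le> H N x / real N + \<kappa>"
      proof (rule energy_le_of_close_moments[OF \<delta>(2) D \<phi> diam _ budget N x(1) y])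
        show "m j - \<eta> \<le> emp_mean N (\<phi> j) x" if "j < k" for j using x(2)[OF that] by linarith
        show "m j - \<eta> \<le> emp_mean N (\<phi> j) y" if "j < k" for j using True that by (smt (verit))
      qed (use \<epsilon> in auto)
      moreover have "0 \<le> C / \<eta>\<^sup>2 * w y" using C w0 by simp
      ultimately show ?thesis using x(3) \<eta>(2) by linarith
    next
      case False
      then obtain j where j: "j < k" "\<eta> < \<bar>emp_mean N (\<phi> j) y - m j\<bar>" by force
      have "\<eta>\<^sup>2 \<le> \<bar>emp_mean N (\<phi> j) y - m j\<bar>\<^sup>2" using j \<eta>(1) by (intro power_mono) auto
      also have "\<dots> = (emp_mean N (\<phi> j) y - m j)\<^sup>2" by simp
      also have "\<dots> \<le> w y" unfolding w_def using j(1) by (intro member_le_sum) auto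
      finally have "C / \<eta>\<^sup>2 * \<eta>\<^sup>2 \<le> C / \<eta>\<^sup>2 * w y" using C by (intro mult_left_mono) auto
      then have "C \<le> C / \<eta>\<^sup>2 * w y" using \<eta>(1) by simp
      moreover have "H N y / real N \<le> H N x / real N + C" using elim(3) x(1) y by blast
      ultimately show ?thesis using x(3) \<eta>(2) \<kappa> by linarith
    qed
    have meas: "\<phi> j \<in> borel_measurable \<mu>" for j
      using borel_measurable_continuous_onI[OF cont] measurable_cong_sets[OF sets refl] by blast
    note var = emp_mean_variance_le[OF assms(1) N meas \<phi>(1,2), folded m_def]
    have intw: "integrable ?P w"
      unfolding w_def using var(1) by (intro Bochner_Integration.integrable_sum) auto
    have "(\<integral>y. w y \<partial>?P) = (\<Sum>j<k. \<integral>y. (emp_mean N (\<phi> j) y - m j)\<^sup>2 \<partial>?P)"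
      unfolding w_def by (rule Bochner_Integration.integral_sum) (rule var(1))
    also have "\<dots> \<le> (\<Sum>j<k. 1 / real N)" by (intro sum_mono var(2))
    finally have "C / \<eta>\<^sup>2 * (\<integral>y. w y \<partial>?P) \<le> C / \<eta>\<^sup>2 * (real k * (1 / real N))"
      using C by (intro mult_left_mono) auto
    then have wle: "C / \<eta>\<^sup>2 * (\<integral>y. w y \<partial>?P) \<le> \<kappa>" using elim(1) by simp
    have "(\<integral>y. H N y / real N \<partial>?P) \<le> (\<integral>y. e + 2 * \<kappa> + C / \<eta>\<^sup>2 * w y \<partial>?P)"
    proof (rule integral_mono)
      show "integrable ?P (\<lambda>y. H N y / real N)" using elim(4) by simp
      show "integrable ?P (\<lambda>y. e + 2 * \<kappa> + C / \<eta>\<^sup>2 * w y)" using intw by simp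
      show "H N y / real N \<le> e + 2 * \<kappa> + C / \<eta>\<^sup>2 * w y" if "y \<in> space ?P" for y
        by (rule pointwise) (use that sets_eq_imp_space_eq[OF sets] in \<open>simp add: space_PiM\<close>)
    qed
    also have "\<dots> = e + 2 * \<kappa> + C / \<eta>\<^sup>2 * (\<integral>y. w y \<partial>?P)"
      using intw P.prob_space by simp
    \<comment> \<open>One \<open>\<kappa>\<close> each comes from the recovery error
      \<open>\<eta>\<close>, from equicontinuity and from the atypical configurations.\<close>
    also have "\<dots> \<le> e + 3 * \<kappa>" using wle by simp
    finally show ?case unfolding mean_energy_def by simp
  qed
qed

section \<open>Convergence of the mean energy to the Legendre supremum\<close>

lemma mean_energy_tendsto_macro_energy:
  fixes \<mu> :: "'a measure"
  assumes "prob_space \<mu>" and "sets \<mu> = sets borel"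
    and "gateaux_differentiable_C0 (limit_energy H)"
  shows "(\<lambda>N. ereal (mean_energy H \<mu> N)) \<longlonglongrightarrow> macro_energy H \<mu>"
proof -
  let ?L = "\<lambda>u. limit_energy H u - (\<integral>x. u x \<partial>\<mu>)"
  define e where "e = (SUP u\<in>C0. ?L u)"
  \<comment> \<open>Boundedness of the mean energy comes first: it makes the supremum finite, so
    that the argument can run with the real number \<open>e\<close>.\<close>
  obtain c where "\<forall>\<^sub>F N in sequentially. mean_energy H \<mu> N \<le> c"
    using mean_energy_bounded[OF assms(1,2)] by blast
  then have "?L u \<le> c" if "u \<in> C0" for u
    by (rule limit_energy_le_of_mean_energy_le[OF assms(1,2) that])
  then have bdd: "bdd_above (?L ` C0)" by (rule bdd_aboveI2)
  have nonempty: "(C0 :: ('a \<Rightarrow> real) set) \<noteq> {}" using continuous_on_const[of UNIV "0::real"] by blast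
  have e_upper: "?L u \<le> e" if "u \<in> C0" for u
    unfolding e_def by (rule cSUP_upper[OF that bdd])
  have macro: "macro_energy H \<mu> = ereal e"
    unfolding macro_energy_def
  proof (rule antisym)
    show "(SUP u\<in>C0. ereal (?L u)) \<le> ereal e"
      by (rule SUP_least) (use e_upper in auto)
    \<comment> \<open>A potential within \<open>d\<close> of the real supremum witnesses the
      inequality up to an arbitrary \<open>d > 0\<close>.\<close>
    show "ereal e \<le> (SUP u\<in>C0. ereal (?L u))"
    proof (rule ereal_le_epsilon2)
      fix d :: real assume "d > 0"
      then have "e - d < (SUP u\<in>C0. ?L u)" unfolding e_def by simp
      then obtain u where u: "u \<in> C0" "e - d < ?L u"
        using less_cSUP_iff[OF nonempty bdd] by blast
      have "ereal e \<le> ereal (?L u) + ereal d" using u(2) by simp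
      also have "\<dots> \<le> (SUP u\<in>C0. ereal (?L u)) + ereal d"
        by (intro add_right_mono SUP_upper u(1))
      finally show "ereal e \<le> (SUP u\<in>C0. ereal (?L u)) + ereal d" .
    qed
  qed
  have "mean_energy H \<mu> \<longlonglongrightarrow> e"
  proof (rule order_tendstoI)
    fix a assume "a < e"
    then obtain u where u: "u \<in> C0" "a < ?L u"
      unfolding e_def using less_cSUP_iff[OF nonempty bdd] by blast
    have "\<forall>\<^sub>F N in sequentially. a + (\<integral>x. u x \<partial>\<mu>) < min_energy H u N"
      by (rule order_tendstoD(1)[OF min_energy_tendsto[OF u(1)]]) (use u(2) in simp)
    then show "\<forall>\<^sub>F N in sequentially. a < mean_energy H \<mu> N"
      using min_energy_le_mean_energy[OF assms(1,2)]
    proof eventually_elim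
      case (elim N)
      then show ?case using u(1) by force
    qed
  next
    fix a assume "e < a"
    then have "(a - e) / 6 > 0" by simp
    \<comment> \<open>Dividing by 6 makes the error \<open>3 * ((a - e) / 6)\<close> half of the
      gap, which leaves the strict inequality below \<open>a\<close>.\<close>
    have "\<forall>\<^sub>F N in sequentially. mean_energy H \<mu> N \<le> e + 3 * ((a - e) / 6)"
      by (rule mean_energy_le[OF assms _ \<open>(a - e) / 6 > 0\<close>]) (rule e_upper)
    then show "\<forall>\<^sub>F N in sequentially. mean_energy H \<mu> N < a"
      by eventually_elim (use \<open>e < a\<close> in argo)
  qed
  then show ?thesis unfolding macro by simp
qed

end

theorem theorem2p1:
  fixes H :: "nat \<Rightarrow> (nat \<Rightarrow> 'a::metric_space) \<Rightarrow> real"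
    and \<mu> :: "'a measure"
  assumes "compact (UNIV :: 'a set)"
    and "\<And>N. N \<ge> 1 \<Longrightarrow> particle_hamiltonian N (H N)"
    and "equicontinuous_per_particle H"
    and "\<And>u. u \<in> C0 \<Longrightarrow> convergent (min_energy H u)"
    and "gateaux_differentiable_C0 (limit_energy H)"
    and "prob_space \<mu>" and "sets \<mu> = sets borel"
  shows "(\<lambda>N. ereal ((1 / real N) * (\<integral>x. H N x \<partial>(PiM {..<N} (\<lambda>_. \<mu>)))))
           \<longlonglongrightarrow> macro_energy H \<mu>"
proof -
  interpret convergent_particle_system H
    by unfold_locales (use assms(1-4) in \<open>auto simp: particle_hamiltonian_def\<close>)
  show ?thesis
    using mean_energy_tendsto_macro_energy[OF assms(6,7,5)] unfolding mean_energy_def .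
qed

end
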